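(* Assume Martin's axiom and $2^{\omega}>\omega_2$. Assume, further, that Chang's conjecture fails. Then there are no weakly Laver ideals over $\aleph_1$.
   Context: Chang's conjecture is the statement that for every structure $\mathfrak{A}=(A,R,\ldots)$ in a countable first order language, with $R$ a unary predicate, $|A|=\aleph_2$ and $|R|=\aleph_1$, there exists an elementary substructure $\mathfrak{B}\prec\mathfrak{A}$ with universe $B$ such that $|B|=\aleph_1$ and $|R^{\mathfrak{B}}|=\aleph_0$. All ideals over a cardinal $\kappa$ are proper and contain all bounded subsets of $\kappa$. For an ideal $\mathcal{I}$ over $\kappa$, $\mathcal{I}^+=\mathcal{P}(\kappa)\setminus\mathcal{I}$. An ideal $\mathcal{I}$ is $(\mu,\lambda,\theta)$-saturated iff for every collection $\{A_\alpha:\alpha<\mu\}\subseteq\mathcal{I}^+$ there is a sub-collection $\{A_{\alpha_\beta}:\beta<\lambda\}$ (with the indices $\alpha_\beta$ distinct) such that $\bigcap_{\beta\in C}A_{\alpha_\beta}\in\mathcal{I}^+$ for every $C\in[\lambda]^{\theta}$. An ideal over $\kappa^+$ is weakly Laver if it is uniform (every set in $\mathcal{I}^+$ has cardinality $\kappa^+$), $\kappa^+$-complete and $(\kappa^{++},\kappa^+,\kappa)$-saturated. Thus a weakly Laver ideal over $\aleph_1$ is a uniform, $\aleph_1$-complete, $(\aleph_2,\aleph_1,\aleph_0)$-saturated ideal over $\aleph_1$. *)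

theory Defs
  imports Main "HOL-Library.Countable_Set"
begin

unbundle cardinal_syntax

text \<open>
  A cardinal is represented by a cardinal order (a well-order that is minimal for its size); its
  field plays the role of the set of ordinals below the cardinal. \<^const>\<open>cardSuc\<close> realises the
  successor of a cardinal on \<^typ>\<open>'a\<close> on the type \<^typ>\<open>'a set\<close>.
\<close>

abbreviation aleph0 :: "nat rel" where
  "aleph0 \<equiv> natLeq"

abbreviation aleph1 :: "nat set rel" where
  "aleph1 \<equiv> cardSuc aleph0"

abbreviation aleph2 :: "nat set set rel" where
  "aleph2 \<equiv> cardSuc aleph1"

abbreviation continuum :: "(nat \<Rightarrow> bool) rel" where
  "continuum \<equiv> ctwo ^c aleph0"


section \<open>Martin's axiom\<close>

text \<open>A pair \<open>(p, q)\<close> in the order of a forcing poset means that \<open>p\<close> is stronger than \<open>q\<close>.\<close>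

definition compatible :: "'p set \<Rightarrow> 'p rel \<Rightarrow> 'p \<Rightarrow> 'p \<Rightarrow> bool" where
  "compatible P le p q \<longleftrightarrow> (\<exists>s\<in>P. (s, p) \<in> le \<and> (s, q) \<in> le)"

definition antichain :: "'p set \<Rightarrow> 'p rel \<Rightarrow> 'p set \<Rightarrow> bool" where
  "antichain P le A \<longleftrightarrow>
     A \<subseteq> P \<and> (\<forall>p\<in>A. \<forall>q\<in>A. p \<noteq> q \<longrightarrow> \<not> compatible P le p q)"

definition ccc :: "'p set \<Rightarrow> 'p rel \<Rightarrow> bool" where
  "ccc P le \<longleftrightarrow> (\<forall>A. antichain P le A \<longrightarrow> countable A)"

definition dense_in :: "'p set \<Rightarrow> 'p rel \<Rightarrow> 'p set \<Rightarrow> bool" where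
  "dense_in P le D \<longleftrightarrow> D \<subseteq> P \<and> (\<forall>p\<in>P. \<exists>d\<in>D. (d, p) \<in> le)"

definition filter_in :: "'p set \<Rightarrow> 'p rel \<Rightarrow> 'p set \<Rightarrow> bool" where
  "filter_in P le G \<longleftrightarrow>
     G \<subseteq> P \<and> G \<noteq> {} \<and>
     (\<forall>p\<in>G. \<forall>q\<in>P. (p, q) \<in> le \<longrightarrow> q \<in> G) \<and>
     (\<forall>p\<in>G. \<forall>q\<in>G. \<exists>s\<in>G. (s, p) \<in> le \<and> (s, q) \<in> le)"

text \<open>
  Martin's axiom for the posets whose elements come from the type \<^typ>\<open>'p\<close>. A formula of HOL
  cannot quantify over types, so the type is a parameter. For every type with at least
  continuum many elements this is the full axiom: the axiom for posets with fewer than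
  continuum many elements implies it for all posets, by passing to a suitable subposet.
\<close>

definition martins_axiom :: "'p itself \<Rightarrow> bool" where
  "martins_axiom (_ :: 'p itself) \<longleftrightarrow>
     (\<forall>(P :: 'p set) le \<D>.
        P \<noteq> {} \<and> partial_order_on P le \<and> ccc P le \<and>
        |\<D>| <o continuum \<and> (\<forall>D\<in>\<D>. dense_in P le D) \<longrightarrow>
        (\<exists>G. filter_in P le G \<and> (\<forall>D\<in>\<D>. G \<inter> D \<noteq> {})))"


section \<open>First-order structures\<close>

text \<open>A language: constants are the function symbols of arity \<open>0\<close>.\<close>

record ('f, 'r) lang =
  fun_syms :: "'f set"
  fun_arity :: "'f \<Rightarrow> nat"
  rel_syms :: "'r set"
  rel_arity :: "'r \<Rightarrow> nat"

definition countable_lang :: "('f, 'r) lang \<Rightarrow> bool" where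
  "countable_lang L \<longleftrightarrow> countable (fun_syms L) \<and> countable (rel_syms L)"

datatype 'f trm = Var nat | App 'f "'f trm list"

datatype ('f, 'r) form =
    Eq "'f trm" "'f trm"
  | Rel 'r "'f trm list"
  | Neg "('f, 'r) form"
  | Conj "('f, 'r) form" "('f, 'r) form"
  | Exists nat "('f, 'r) form"

fun trm_of :: "('f, 'r) lang \<Rightarrow> 'f trm \<Rightarrow> bool" where
  "trm_of L (Var x) \<longleftrightarrow> True"
| "trm_of L (App f ts) \<longleftrightarrow>
     f \<in> fun_syms L \<and> length ts = fun_arity L f \<and> (\<forall>t\<in>set ts. trm_of L t)"

fun form_of :: "('f, 'r) lang \<Rightarrow> ('f, 'r) form \<Rightarrow> bool" where
  "form_of L (Eq s t) \<longleftrightarrow> trm_of L s \<and> trm_of L t"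
| "form_of L (Rel r ts) \<longleftrightarrow>
     r \<in> rel_syms L \<and> length ts = rel_arity L r \<and> (\<forall>t\<in>set ts. trm_of L t)"
| "form_of L (Neg \<phi>) \<longleftrightarrow> form_of L \<phi>"
| "form_of L (Conj \<phi> \<psi>) \<longleftrightarrow> form_of L \<phi> \<and> form_of L \<psi>"
| "form_of L (Exists x \<phi>) \<longleftrightarrow> form_of L \<phi>"

record ('a, 'f, 'r) struct =
  universe :: "'a set"
  fun_interp :: "'f \<Rightarrow> 'a list \<Rightarrow> 'a"
  rel_interp :: "'r \<Rightarrow> 'a list \<Rightarrow> bool"

text \<open>
  Interpretations matter only for symbols of the language and for argument lists of the right
  length from the universe; elsewhere their values are arbitrary.
\<close>

definition structure_of :: "('f, 'r) lang \<Rightarrow> ('a, 'f, 'r) struct \<Rightarrow> bool" where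
  "structure_of L M \<longleftrightarrow>
     universe M \<noteq> {} \<and>
     (\<forall>f\<in>fun_syms L. \<forall>xs\<in>lists (universe M).
        length xs = fun_arity L f \<longrightarrow> fun_interp M f xs \<in> universe M)"

fun eval_trm :: "('a, 'f, 'r) struct \<Rightarrow> (nat \<Rightarrow> 'a) \<Rightarrow> 'f trm \<Rightarrow> 'a" where
  "eval_trm M e (Var x) = e x"
| "eval_trm M e (App f ts) = fun_interp M f (map (eval_trm M e) ts)"

fun sat :: "('a, 'f, 'r) struct \<Rightarrow> (nat \<Rightarrow> 'a) \<Rightarrow> ('f, 'r) form \<Rightarrow> bool" where
  "sat M e (Eq s t) \<longleftrightarrow> eval_trm M e s = eval_trm M e t"
| "sat M e (Rel r ts) \<longleftrightarrow> rel_interp M r (map (eval_trm M e) ts)"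
| "sat M e (Neg \<phi>) \<longleftrightarrow> \<not> sat M e \<phi>"
| "sat M e (Conj \<phi> \<psi>) \<longleftrightarrow> sat M e \<phi> \<and> sat M e \<psi>"
| "sat M e (Exists x \<phi>) \<longleftrightarrow> (\<exists>a\<in>universe M. sat M (e(x := a)) \<phi>)"

definition substructure ::
  "('f, 'r) lang \<Rightarrow> ('a, 'f, 'r) struct \<Rightarrow> ('a, 'f, 'r) struct \<Rightarrow> bool" where
  "substructure L N M \<longleftrightarrow>
     structure_of L N \<and> structure_of L M \<and> universe N \<subseteq> universe M \<and>
     (\<forall>f\<in>fun_syms L. \<forall>xs\<in>lists (universe N).
        length xs = fun_arity L f \<longrightarrow> fun_interp N f xs = fun_interp M f xs) \<and>
     (\<forall>r\<in>rel_syms L. \<forall>xs\<in>lists (universe N).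
        length xs = rel_arity L r \<longrightarrow> rel_interp N r xs = rel_interp M r xs)"

definition elementary_substructure ::
  "('f, 'r) lang \<Rightarrow> ('a, 'f, 'r) struct \<Rightarrow> ('a, 'f, 'r) struct \<Rightarrow> bool" where
  "elementary_substructure L N M \<longleftrightarrow>
     substructure L N M \<and>
     (\<forall>\<phi> e. form_of L \<phi> \<and> range e \<subseteq> universe N \<longrightarrow> (sat N e \<phi> \<longleftrightarrow> sat M e \<phi>))"

definition unary_set :: "('a, 'f, 'r) struct \<Rightarrow> 'r \<Rightarrow> 'a set" where
  "unary_set M R = {a \<in> universe M. rel_interp M R [a]}"


section \<open>Chang's conjecture\<close>

text \<open>
  The conjecture for structures with elements in \<^typ>\<open>'a\<close> and symbols in \<^typ>\<open>'f\<close> and \<^typ>\<open>'r\<close>.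
  It is vacuous if \<^typ>\<open>'a\<close> has fewer than \<open>aleph2\<close> many elements. The conjecture
  fails iff it fails for some choice of the types, so its failure is to be assumed for
  arbitrary types.
\<close>

definition chang_conjecture :: "'a itself \<Rightarrow> 'f itself \<Rightarrow> 'r itself \<Rightarrow> bool" where
  "chang_conjecture (_ :: 'a itself) (_ :: 'f itself) (_ :: 'r itself) \<longleftrightarrow>
     (\<forall>(L :: ('f, 'r) lang) (M :: ('a, 'f, 'r) struct) R.
        countable_lang L \<and> R \<in> rel_syms L \<and> rel_arity L R = 1 \<and> structure_of L M \<and>
        |universe M| =o aleph2 \<and> |unary_set M R| =o aleph1 \<longrightarrow>
        (\<exists>N. elementary_substructure L N M \<and>
           |universe N| =o aleph1 \<and> |unary_set N R| =o aleph0))"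


section \<open>Weakly Laver ideals\<close>

definition bounded_in :: "'k rel \<Rightarrow> 'k set \<Rightarrow> bool" where
  "bounded_in \<kappa> X \<longleftrightarrow> X \<subseteq> Field \<kappa> \<and> (\<exists>b\<in>Field \<kappa>. \<forall>x\<in>X. (x, b) \<in> \<kappa>)"

definition ideal_over :: "'k rel \<Rightarrow> 'k set set \<Rightarrow> bool" where
  "ideal_over \<kappa> I \<longleftrightarrow>
     I \<subseteq> Pow (Field \<kappa>) \<and>
     (\<forall>X\<in>I. \<forall>Y. Y \<subseteq> X \<longrightarrow> Y \<in> I) \<and>
     (\<forall>X\<in>I. \<forall>Y\<in>I. X \<union> Y \<in> I) \<and>
     Field \<kappa> \<notin> I \<and>
     (\<forall>X. bounded_in \<kappa> X \<longrightarrow> X \<in> I)"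

definition positive_sets :: "'k rel \<Rightarrow> 'k set set \<Rightarrow> 'k set set" where
  "positive_sets \<kappa> I = Pow (Field \<kappa>) - I"

definition uniform_ideal :: "'k rel \<Rightarrow> 'k set set \<Rightarrow> bool" where
  "uniform_ideal \<kappa> I \<longleftrightarrow> (\<forall>X\<in>positive_sets \<kappa> I. |X| =o \<kappa>)"

definition complete_ideal :: "'m rel \<Rightarrow> 'k set set \<Rightarrow> bool" where
  "complete_ideal \<mu> I \<longleftrightarrow> (\<forall>\<X>. \<X> \<subseteq> I \<and> |\<X>| <o \<mu> \<longrightarrow> \<Union>\<X> \<in> I)"

text \<open>
  \<open>(\<mu>, \<nu>, \<theta>)\<close>-saturation of an ideal over \<open>\<kappa>\<close>; \<open>h\<close> lists the indices of the subfamily.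
\<close>

definition saturated_ideal ::
  "'k rel \<Rightarrow> 'm rel \<Rightarrow> 'l rel \<Rightarrow> 't rel \<Rightarrow> 'k set set \<Rightarrow> bool" where
  "saturated_ideal \<kappa> \<mu> \<nu> \<theta> I \<longleftrightarrow>
     (\<forall>A :: 'm \<Rightarrow> 'k set. (\<forall>\<alpha>\<in>Field \<mu>. A \<alpha> \<in> positive_sets \<kappa> I) \<longrightarrow>
        (\<exists>h :: 'l \<Rightarrow> 'm. inj_on h (Field \<nu>) \<and> h ` Field \<nu> \<subseteq> Field \<mu> \<and>
           (\<forall>C. C \<subseteq> Field \<nu> \<and> |C| =o \<theta> \<longrightarrow>
              (\<Inter>\<beta>\<in>C. A (h \<beta>)) \<in> positive_sets \<kappa> I)))"

text \<open>The ideal lives on the successor cardinal of the cardinal \<open>\<kappa>\<close>.\<close>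

definition weakly_laver :: "'k rel \<Rightarrow> 'k set set set \<Rightarrow> bool" where
  "weakly_laver \<kappa> I \<longleftrightarrow>
     ideal_over (cardSuc \<kappa>) I \<and>
     uniform_ideal (cardSuc \<kappa>) I \<and>
     complete_ideal (cardSuc \<kappa>) I \<and>
     saturated_ideal (cardSuc \<kappa>) (cardSuc (cardSuc \<kappa>)) (cardSuc \<kappa>) \<kappa> I"

end

theory Submission
  imports Defs "HOL-Library.Countable_Set_Type"
begin

text \<open>
  Let \<open>U\<close>, \<open>R\<close> be a structure of type \<open>(\<aleph>\<^sub>2, \<aleph>\<^sub>1)\<close> with Skolem functions refuting Chang's conjecture. For
  \<open>\<delta> < \<omega>\<^sub>1\<close>, the points \<open>\<alpha>\<close> of \<open>U\<close> whose Skolem hull over \<open>\<delta>\<close> meets \<open>R\<close> in exactly \<open>\<delta>\<close> are ordered as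
  a tree by \<open>\<alpha> \<in> Sk(\<delta> \<union> {\<beta>})\<close>. An uncountable chain would have a union witnessing Chang's conjecture
  for \<open>U\<close>, so the finite specializing conditions are ccc (Baumgartner, Malitz, Reinhardt) and Martin's
  axiom for \<open>\<aleph>\<^sub>2\<close> dense sets colours the tree with countably many colours, injectively on chains.

  A weakly Laver ideal \<open>I\<close> is \<open>\<aleph>\<^sub>2\<close>-saturated, so some \<open>h : \<omega>\<^sub>1 \<rightarrow> \<omega>\<^sub>1\<close> represents \<open>\<omega>\<^sub>1\<close> in the generic
  ultrapower below a positive set \<open>A\<close>. For fixed \<open>\<alpha>\<close> and almost all \<open>x \<in> A\<close> the point \<open>\<alpha>\<close> lies in the
  tree at \<open>h x\<close>; let \<open>A\<^sub>\<alpha>\<close> be a positive set of \<open>x\<close> at which its colour is a constant \<open>n\<^sub>\<alpha>\<close>. Saturation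
  gives \<open>\<alpha> < \<beta>\<close> with \<open>n\<^sub>\<alpha> = n\<^sub>\<beta>\<close> and \<open>A\<^sub>\<alpha> \<inter> A\<^sub>\<beta>\<close> positive. But \<open>\<alpha>\<close> is below \<open>\<beta>\<close> in the tree at \<open>h x\<close> as
  soon as \<open>h x\<close> is large, which excludes equal colours.
\<close>

section \<open>Hulls under countably many finitary operations\<close>

text \<open>Operations carry no arity: closure is required for lists of every length, so
  \<open>g []\<close> acts as a constant.\<close>

definition closed_under :: "('a list \<Rightarrow> 'a) set \<Rightarrow> 'a set \<Rightarrow> bool" where
  "closed_under \<G> B \<longleftrightarrow> (\<forall>g\<in>\<G>. \<forall>xs\<in>lists B. g xs \<in> B)"

inductive_set hull :: "('a list \<Rightarrow> 'a) set \<Rightarrow> 'a set \<Rightarrow> 'a set"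
  for \<G> :: "('a list \<Rightarrow> 'a) set" and X :: "'a set" where
  base: "x \<in> X \<Longrightarrow> x \<in> hull \<G> X"
| step: "g \<in> \<G> \<Longrightarrow> xs \<in> lists (hull \<G> X) \<Longrightarrow> g xs \<in> hull \<G> X"

lemma subset_hull: "X \<subseteq> hull \<G> X"
  by (auto intro: hull.base)

lemma closed_under_hull: "closed_under \<G> (hull \<G> X)"
  by (auto simp: closed_under_def intro: hull.step)

lemma hull_subset:
  assumes "X \<subseteq> B" "closed_under \<G> B"
  shows "hull \<G> X \<subseteq> B"
proof
  fix x assume "x \<in> hull \<G> X"
  then show "x \<in> B"
    by induction (use assms in \<open>auto simp: closed_under_def lists_eq_set\<close>)
qed

lemma hull_mono: "X \<subseteq> Y \<Longrightarrow> hull \<G> X \<subseteq> hull \<G> Y"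
  by (meson closed_under_hull hull_subset order_trans subset_hull)

lemma finite_subset_directed_Union:
  assumes "finite F" "F \<subseteq> \<Union>\<C>" "\<C> \<noteq> {}"
    and dir: "\<And>B C. B \<in> \<C> \<Longrightarrow> C \<in> \<C> \<Longrightarrow> \<exists>D\<in>\<C>. B \<union> C \<subseteq> D"
  shows "\<exists>D\<in>\<C>. F \<subseteq> D"
  using assms(1,2)
proof (induction F)
  case empty
  then show ?case using \<open>\<C> \<noteq> {}\<close> by blast
next
  case (insert x F)
  then obtain C where "C \<in> \<C>" "F \<subseteq> C" by auto
  moreover obtain D where "D \<in> \<C>" "x \<in> D" using insert.prems by auto
  ultimately show ?case using dir[of C D] by blast
qed

lemma closed_under_directed_Union:
  assumes "\<And>B. B \<in> \<C> \<Longrightarrow> closed_under \<G> B" "\<C> \<noteq> {}"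
    and "\<And>B C. B \<in> \<C> \<Longrightarrow> C \<in> \<C> \<Longrightarrow> \<exists>D\<in>\<C>. B \<union> C \<subseteq> D"
  shows "closed_under \<G> (\<Union>\<C>)"
  unfolding closed_under_def
proof (intro ballI)
  fix g xs assume g: "g \<in> \<G>" and xs: "xs \<in> lists (\<Union>\<C>)"
  have "set xs \<subseteq> \<Union>\<C>" using xs by (auto simp: lists_eq_set)
  then obtain D where "D \<in> \<C>" "set xs \<subseteq> D"
    using finite_subset_directed_Union[OF finite_set, of xs \<C>] assms(2,3) by metis
  then show "g xs \<in> \<Union>\<C>"
    using assms(1)[of D] g by (auto simp: closed_under_def lists_eq_set)
qed

text \<open>Hulls of finite subsets form a directed family, so their union is closed. In
  \<open>almost_all_good\<close> this confines an element of a hull to finitely many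
  generators.\<close>

lemma hull_finitary: "hull \<G> X = (\<Union>F\<in>Fpow X. hull \<G> F)"
proof
  have "closed_under \<G> (\<Union>(hull \<G> ` Fpow X))"
  proof (rule closed_under_directed_Union)
    show "hull \<G> ` Fpow X \<noteq> {}" by (auto simp: Fpow_def)
    fix B C assume "B \<in> hull \<G> ` Fpow X" "C \<in> hull \<G> ` Fpow X"
    then obtain F H where "B = hull \<G> F" "C = hull \<G> H" "F \<in> Fpow X" "H \<in> Fpow X" by blast
    moreover from this have "F \<union> H \<in> Fpow X" by (auto simp: Fpow_def)
    ultimately show "\<exists>D\<in>hull \<G> ` Fpow X. B \<union> C \<subseteq> D"
      by (intro bexI[of _ "hull \<G> (F \<union> H)"]) (auto intro: hull_mono[THEN subsetD])
  qed (auto simp: closed_under_hull)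
  moreover have "x \<in> (\<Union>F\<in>Fpow X. hull \<G> F)" if "x \<in> X" for x
    using that by (intro UN_I[of "{x}"]) (auto simp: Fpow_def hull.base)
  ultimately show "hull \<G> X \<subseteq> (\<Union>F\<in>Fpow X. hull \<G> F)"
    by (intro hull_subset) auto
qed (auto simp: Fpow_def dest: hull_mono)

text \<open>Lists are finite, so closing off \<open>\<omega>\<close> times is enough, and a
  countable stage has only countably many lists to feed into the operations.\<close>

lemma countable_hull:
  assumes "countable \<G>" "countable X"
  shows "countable (hull \<G> X)"
proof -
  define L where "L n = ((\<lambda>Y. Y \<union> (\<Union>g\<in>\<G>. g ` lists Y)) ^^ n) X" for n
  have L0: "L 0 = X" and LS: "L (Suc n) = L n \<union> (\<Union>g\<in>\<G>. g ` lists (L n))" for n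
    by (auto simp: L_def)
  have mono: "m \<le> n \<Longrightarrow> L m \<subseteq> L n" for m n
    by (rule lift_Suc_mono_le[of L]) (auto simp: LS)
  have "closed_under \<G> (\<Union>(range L))"
    unfolding closed_under_def
  proof (intro ballI)
    fix g xs assume g: "g \<in> \<G>" and "xs \<in> lists (\<Union>(range L))"
    then have "set xs \<subseteq> \<Union>(range L)" by (auto simp: lists_eq_set)
    then have "\<exists>D\<in>range L. set xs \<subseteq> D"
    proof (rule finite_subset_directed_Union[OF finite_set])
      show "\<exists>D\<in>range L. B \<union> C \<subseteq> D" if "B \<in> range L" "C \<in> range L" for B C
        using that mono by (metis (no_types, opaque_lifting) Un_subset_iff imageE max.cobounded1 max.cobounded2 rangeI)
    qed auto
    then obtain n where "set xs \<subseteq> L n" by auto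
    then have "g xs \<in> L (Suc n)" using g by (auto simp: LS lists_eq_set)
    then show "g xs \<in> \<Union>(range L)" by blast
  qed
  moreover have "X \<subseteq> \<Union>(range L)" using L0 by blast
  ultimately have "hull \<G> X \<subseteq> \<Union>(range L)" by (rule hull_subset[rotated])
  moreover have "countable (L n)" for n
    by (induction n) (use assms in \<open>auto simp: L0 LS\<close>)
  ultimately show ?thesis by (meson countable_UN countable_subset uncountable_def countableI_type)
qed

section \<open>Skolem functions\<close>

text \<open>Syntax is itself a hull: the constructors act as operations on the variables, which
  reduces counting terms to \<open>countable_hull\<close>. Formulas are treated alike below.\<close>

lemma countable_trm_of:
  assumes "countable (fun_syms L)"
  shows "countable {t. trm_of L t}"
proof (rule countable_subset)
  let ?H = "hull (App ` fun_syms L) (range Var)"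
  show "countable ?H" using assms by (intro countable_hull) auto
  have "t \<in> ?H" if "trm_of L t" for t using that
  proof (induction t)
    case (App f ts)
    then show ?case by (intro hull.step) (auto simp: lists_eq_set)
  qed (simp add: hull.base)
  then show "{t. trm_of L t} \<subseteq> ?H" by blast
qed

lemma countable_form_of:
  assumes "countable_lang L"
  shows "countable {\<phi>. form_of L \<phi>}"
proof (rule countable_subset)
  let ?T = "{t. trm_of L t}"
  \<comment> \<open>Lists that are too short give unspecified formulas, which at most enlarge the
    hull.\<close>
  define \<G> :: "(('a,'b) form list \<Rightarrow> ('a,'b) form) set" where
    "\<G> = {\<lambda>xs. Neg (xs ! 0), \<lambda>xs. Conj (xs ! 0) (xs ! 1)} \<union> range (\<lambda>n xs. Exists n (xs ! 0))"
  define X :: "('a,'b) form set" where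
    "X = (\<lambda>(s, t). Eq s t) ` (?T \<times> ?T) \<union> (\<lambda>(r, ts). Rel r ts) ` (rel_syms L \<times> lists ?T)"
  have T: "countable ?T" using assms countable_trm_of by (auto simp: countable_lang_def)
  show "countable (hull \<G> X)"
    using assms T by (intro countable_hull) (auto simp: \<G>_def X_def countable_lang_def)
  have "\<phi> \<in> hull \<G> X" if "form_of L \<phi>" for \<phi>
    using that
  proof (induction \<phi>)
    case (Neg \<phi>)
    then have "(\<lambda>xs. Neg (xs ! 0)) [\<phi>] \<in> hull \<G> X"
      by (intro hull.step) (auto simp: \<G>_def)
    then show ?case by simp
  next
    case (Conj \<phi> \<psi>)
    then have "(\<lambda>xs. Conj (xs ! 0) (xs ! 1)) [\<phi>, \<psi>] \<in> hull \<G> X"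
      by (intro hull.step) (auto simp: \<G>_def)
    then show ?case by simp
  next
    case (Exists n \<phi>)
    then have "(\<lambda>xs. Exists n (xs ! 0)) [\<phi>] \<in> hull \<G> X"
      by (intro hull.step) (auto simp: \<G>_def)
    then show ?case by simp
  qed (auto intro!: hull.base simp: X_def lists_eq_set image_iff)
  then show "{\<phi>. form_of L \<phi>} \<subseteq> hull \<G> X" by blast
qed

text \<open>Assignments are infinite sequences, whereas Skolem functions take finite lists. This
  lemma and the next two allow an assignment to be cut off at a finite bound.\<close>

lemma eval_trm_finitary:
  "\<exists>N. \<forall>e e'. (\<forall>i<N. e i = e' i) \<longrightarrow> eval_trm M e t = eval_trm M e' t"
proof (induction t)
  case (Var x)
  show ?case by (rule exI[of _ "Suc x"]) simp
next
  case (App f ts)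
  then obtain N where N: "\<And>t e e'. t \<in> set ts \<Longrightarrow> \<forall>i<N t. e i = e' i \<Longrightarrow>
      eval_trm M e t = eval_trm M e' t"
    by metis
  have le: "t \<in> set ts \<Longrightarrow> N t \<le> Max (N ` set ts)" for t by simp
  have "map (eval_trm M e) ts = map (eval_trm M e') ts" if "\<forall>i<Max (N ` set ts). e i = e' i" for e e'
    using that N le by (intro map_cong refl) (meson less_le_trans)
  then show ?case by (intro exI[of _ "Max (N ` set ts)"]) (metis eval_trm.simps(2))
qed

lemma map_eval_trm_finitary:
  "\<exists>N. \<forall>e e'. (\<forall>i<N. e i = e' i) \<longrightarrow> map (eval_trm M e) ts = map (eval_trm M e') ts"
proof (induction ts)
  case (Cons t ts)
  then obtain m where "\<forall>e e'. (\<forall>i<m. e i = e' i) \<longrightarrow> map (eval_trm M e) ts = map (eval_trm M e') ts"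
    by blast
  moreover obtain n where "\<forall>e e'. (\<forall>i<n. e i = e' i) \<longrightarrow> eval_trm M e t = eval_trm M e' t"
    using eval_trm_finitary by blast
  ultimately show ?case
    by (intro exI[of _ "max m n"]) (metis less_max_iff_disj list.simps(9))
qed simp

lemma sat_finitary:
  "\<exists>N. \<forall>e e'. (\<forall>i<N. e i = e' i) \<longrightarrow> sat M e \<phi> = sat M e' \<phi>"
proof (induction \<phi>)
  case (Eq s t)
  obtain N where N: "\<And>e e'. (\<forall>i<N. e i = e' i) \<Longrightarrow>
      map (eval_trm M e) [s, t] = map (eval_trm M e') [s, t]"
    using map_eval_trm_finitary[of M "[s, t]"] by blast
  have "sat M e (Eq s t) = sat M e' (Eq s t)" if "\<forall>i<N. e i = e' i" for e e'
    using N[OF that] by simp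
  then show ?case by blast
next
  case (Rel r ts)
  obtain N where N: "\<And>e e'. (\<forall>i<N. e i = e' i) \<Longrightarrow>
      map (eval_trm M e) ts = map (eval_trm M e') ts"
    using map_eval_trm_finitary[of M ts] by blast
  have "sat M e (Rel r ts) = sat M e' (Rel r ts)" if "\<forall>i<N. e i = e' i" for e e'
    using N[OF that] by (simp del: map_eq_conv)
  then show ?case by blast
next
  case (Conj \<phi> \<psi>)
  then obtain m n where
    "\<forall>e e'. (\<forall>i<m. e i = e' i) \<longrightarrow> sat M e \<phi> = sat M e' \<phi>"
    "\<forall>e e'. (\<forall>i<n. e i = e' i) \<longrightarrow> sat M e \<psi> = sat M e' \<psi>" by blast
  then show ?case by (intro exI[of _ "max m n"]) (metis less_max_iff_disj sat.simps(4))
next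
  case (Exists x \<phi>)
  then obtain n where n: "\<And>e e'. (\<forall>i<n. e i = e' i) \<Longrightarrow> sat M e \<phi> = sat M e' \<phi>" by blast
  have "sat M (e(x := a)) \<phi> = sat M (e'(x := a)) \<phi>" if "\<forall>i<n. e i = e' i" for e e' a
    using that by (intro n) simp
  then show ?case by (intro exI[of _ n]) auto
qed auto

text \<open>The Tarski-Vaught test. In the induction on formulas, \<open>witness\<close> is needed
  only to bring an existential statement from \<open>M\<close> down to \<open>B\<close>.\<close>

lemma elementary_substructure_restrict:
  assumes M: "structure_of L M" and B: "B \<subseteq> universe M" "B \<noteq> {}"
    and funs: "\<And>f xs. f \<in> fun_syms L \<Longrightarrow> xs \<in> lists B \<Longrightarrow> length xs = fun_arity L f \<Longrightarrow>
      fun_interp M f xs \<in> B"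
    and witness: "\<And>\<phi> x e a. form_of L \<phi> \<Longrightarrow> range e \<subseteq> B \<Longrightarrow> a \<in> universe M \<Longrightarrow>
      sat M (e(x := a)) \<phi> \<Longrightarrow> \<exists>b\<in>B. sat M (e(x := b)) \<phi>"
  shows "elementary_substructure L (M\<lparr>universe := B\<rparr>) M"
proof -
  let ?N = "M\<lparr>universe := B\<rparr>"
  have eval: "eval_trm ?N e t = eval_trm M e t" for e t
    by (induction t) (auto cong: map_cong)
  then have eval': "eval_trm ?N e = eval_trm M e" for e by blast
  have "sat ?N e \<phi> \<longleftrightarrow> sat M e \<phi>" if "form_of L \<phi>" "range e \<subseteq> B" for \<phi> e
    using that
  proof (induction \<phi> arbitrary: e)
    case (Exists x \<phi>)
    have IH: "sat ?N (e(x := b)) \<phi> \<longleftrightarrow> sat M (e(x := b)) \<phi>" if "b \<in> B" for b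
      using Exists that by (intro Exists.IH) (auto simp: image_subset_iff)
    have "form_of L \<phi>" using Exists.prems by simp
    then show ?case using IH witness[of \<phi> e _ x] B Exists.prems(2) by auto
  qed (auto simp: eval')
  then show ?thesis
    using assms by (auto simp: elementary_substructure_def substructure_def structure_of_def)
qed

text \<open>Adding Skolem functions makes every closed subset an elementary substructure, so a
  counterexample becomes an algebra in which \<open>R\<close> is the only set to be
  remembered.\<close>

lemma no_chang_algebra:
  assumes "\<not> chang_conjecture TYPE('a) TYPE('f) TYPE('r)"
  obtains U R :: "'a set" and \<G> :: "('a list \<Rightarrow> 'a) set"
  where "|U| =o aleph2" "|R| =o aleph1" "R \<subseteq> U" "countable \<G>" "closed_under \<G> U"
    "\<And>B. B \<subseteq> U \<Longrightarrow> closed_under \<G> B \<Longrightarrow> |B| =o aleph1 \<Longrightarrow> \<not> |B \<inter> R| =o aleph0"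
proof -
  obtain L :: "('f, 'r) lang" and M :: "('a, 'f, 'r) struct" and R where
    L: "countable_lang L" "R \<in> rel_syms L" "rel_arity L R = 1" and M: "structure_of L M"
    and cards: "|universe M| =o aleph2" "|unary_set M R| =o aleph1"
    and no: "\<And>N. elementary_substructure L N M \<Longrightarrow> |universe N| =o aleph1 \<Longrightarrow>
        \<not> |unary_set N R| =o aleph0"
    using assms unfolding chang_conjecture_def by blast
  let ?U = "universe M"
  obtain u where u: "u \<in> ?U" using M by (auto simp: structure_of_def)
  \<comment> \<open>The default \<open>u\<close> totalizes the interpretation, since closure is
    demanded for lists of all lengths.\<close>
  define app where "app f xs = (if xs \<in> lists ?U \<and> length xs = fun_arity L f then fun_interp M f xs else u)"
    for f xs
  define env where "env xs i = (if i < length xs then xs ! i else u)" for xs i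
  define sk where "sk = (\<lambda>(\<phi>, x) xs. if \<exists>a\<in>?U. sat M ((env xs)(x := a)) \<phi>
      then SOME a. a \<in> ?U \<and> sat M ((env xs)(x := a)) \<phi> else u)"
  \<comment> \<open>The constant operation with value \<open>u\<close> makes closed sets
    nonempty.\<close>
  define \<G> where "\<G> = app ` fun_syms L \<union> sk ` ({\<phi>. form_of L \<phi>} \<times> UNIV) \<union> {\<lambda>_. u}"
  have sk: "sk (\<phi>, x) xs \<in> ?U \<and> sat M ((env xs)(x := sk (\<phi>, x) xs)) \<phi>"
    if "a \<in> ?U" "sat M ((env xs)(x := a)) \<phi>" for \<phi> x xs a
  proof -
    have "\<exists>a. a \<in> ?U \<and> sat M ((env xs)(x := a)) \<phi>" using that by blast
    from someI_ex[OF this] show ?thesis using that by (auto simp: sk_def)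
  qed
  have skU: "sk (\<phi>, x) xs \<in> ?U" for \<phi> x xs
  proof (cases "\<exists>a\<in>?U. sat M ((env xs)(x := a)) \<phi>")
    case True
    then show ?thesis using sk by blast
  next
    case False
    then show ?thesis using u by (simp add: sk_def)
  qed
  have appU: "app f xs \<in> ?U" if "f \<in> fun_syms L" for f xs
    using M u that by (simp add: app_def structure_of_def)
  show ?thesis
  proof (rule that[of ?U "unary_set M R" \<G>])
    show "countable \<G>"
      using L countable_form_of[of L] by (auto simp: \<G>_def countable_lang_def)
    show "closed_under \<G> ?U"
      using appU u skU by (auto simp: closed_under_def \<G>_def)
    fix B assume B: "B \<subseteq> ?U" "closed_under \<G> B" "|B| =o aleph1"
    have "\<forall>g\<in>\<G>. g [] \<in> B" using B(2) by (simp add: closed_under_def)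
    then have uB: "u \<in> B" by (auto simp: \<G>_def)
    have "elementary_substructure L (M\<lparr>universe := B\<rparr>) M"
    proof (rule elementary_substructure_restrict[OF M B(1)])
      show "B \<noteq> {}" using uB by blast
      fix f xs assume "f \<in> fun_syms L" "xs \<in> lists B" "length xs = fun_arity L f"
      moreover from this have "app f xs \<in> B"
        using B(2) unfolding closed_under_def \<G>_def by blast
      moreover have "xs \<in> lists ?U" using \<open>xs \<in> lists B\<close> B(1) lists_mono by blast
      ultimately show "fun_interp M f xs \<in> B" by (simp add: app_def)
    next
      fix \<phi> x e a assume \<phi>: "form_of L \<phi>" and e: "range e \<subseteq> B" and a: "a \<in> ?U"
        and sat: "sat M (e(x := a)) \<phi>"
      \<comment> \<open>The first \<open>N\<close> values of the assignment form a list over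
        \<open>B\<close>, hence an argument of the Skolem function; the padding by
        \<open>env\<close> beyond \<open>N\<close> does not affect \<phi>.\<close>
      obtain N where N: "\<And>e e'. (\<forall>i<N. e i = e' i) \<Longrightarrow> sat M e \<phi> = sat M e' \<phi>"
        using sat_finitary[of M \<phi>] by metis
      let ?xs = "map e [0..<N]"
      have eq: "sat M ((env ?xs)(x := b)) \<phi> = sat M (e(x := b)) \<phi>" for b
        by (rule N) (auto simp: env_def)
      have "sk (\<phi>, x) ?xs \<in> B"
      proof -
        have "?xs \<in> lists B" using e by (auto simp: image_subset_iff)
        moreover have "sk (\<phi>, x) \<in> \<G>" using \<phi> by (auto simp: \<G>_def)
        ultimately show ?thesis using B(2) by (simp add: closed_under_def)
      qed
      then show "\<exists>b\<in>B. sat M (e(x := b)) \<phi>" using sk[OF a, of ?xs x \<phi>] eq sat by blast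
    qed
    moreover have "unary_set (M\<lparr>universe := B\<rparr>) R = B \<inter> unary_set M R"
      using B(1) by (auto simp: unary_set_def)
    ultimately show "\<not> |B \<inter> unary_set M R| =o aleph0" using no[of "M\<lparr>universe := B\<rparr>"] B(3) by simp
  qed (use cards in \<open>auto simp: unary_set_def\<close>)
qed

section \<open>Ideals on the first uncountable cardinal\<close>

lemma countable_card_of_ordLess_aleph1: "countable X \<longleftrightarrow> |X| <o aleph1"
  using cardSuc_ordLeq_ordLess[OF natLeq_Card_order card_of_Card_order[of X]]
  by (simp add: countable_card_le_natLeq)

lemma Field_aleph1_uncountable: "uncountable (Field aleph1)"
  unfolding countable_card_of_ordLess_aleph1
  using card_of_Field_ordIso[OF cardSuc_Card_order[OF natLeq_Card_order]]
  by (meson not_ordLess_ordIso)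

lemma countable_underS_aleph1: "countable (underS aleph1 \<delta>)"
proof (cases "\<delta> \<in> Field aleph1")
  case True
  then show ?thesis
    using card_of_underS[OF cardSuc_Card_order[OF natLeq_Card_order]]
    by (simp add: countable_card_of_ordLess_aleph1)
next
  case False
  then have "underS aleph1 \<delta> = {}" by (auto simp: underS_def Field_def)
  then show ?thesis by simp
qed

lemma ex_infinite_countable_subset:
  assumes "infinite X"
  obtains C where "C \<subseteq> X" "|C| =o natLeq" "infinite C"
  using assms by (metis countable_card_le_natLeq infinite_countable_subset' infinite_iff_natLeq_ordLeq ordIso_iff_ordLeq)

section \<open>The order of \<open>\<omega>\<^sub>1\<close> and closure properties of the
  ideal\<close>

locale weakly_laver_ideal =
  fixes I :: "nat set set set"
  assumes weakly_laver: "weakly_laver aleph0 I"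
begin

abbreviation W :: "nat set set" where "W \<equiv> Field aleph1"

abbreviation less_W (infix "\<prec>" 50) where "\<xi> \<prec> \<delta> \<equiv> \<xi> \<in> underS aleph1 \<delta>"

lemma Well_order_aleph1: "Well_order aleph1"
  by (simp add: cardSuc_Well_order natLeq_Card_order)

lemma wf_less_W: "wf (aleph1 - Id)"
  using Well_order_aleph1 by (simp add: well_order_on_def)

lemma less_W_linear: "\<xi> \<in> W \<Longrightarrow> \<delta> \<in> W \<Longrightarrow> \<xi> \<prec> \<delta> \<or> \<xi> = \<delta> \<or> \<delta> \<prec> \<xi>"
  using Well_order_aleph1
  by (auto simp: underS_def well_order_on_def linear_order_on_def total_on_def)

lemma less_W_irrefl: "\<not> \<xi> \<prec> \<xi>"
  by (simp add: underS_def)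

lemma less_W_trans: "\<xi> \<prec> \<eta> \<Longrightarrow> \<eta> \<prec> \<delta> \<Longrightarrow> \<xi> \<prec> \<delta>"
  using Well_order_aleph1
  by (auto simp: underS_def well_order_on_def linear_order_on_def partial_order_on_def
      preorder_on_def dest: transD antisymD)

lemma less_W_Field: "\<xi> \<prec> \<delta> \<Longrightarrow> \<xi> \<in> W" "\<xi> \<prec> \<delta> \<Longrightarrow> \<delta> \<in> W"
  by (auto simp: underS_def Field_def)

text \<open>Regularity of \<open>\<omega>\<^sub>1\<close>: the initial segments below points of
  \<open>X\<close> have a countable union, and by linearity any point outside it and outside
  \<open>X\<close> lies above \<open>X\<close>.\<close>

lemma ex_upper_bound:
  assumes "countable X" "X \<subseteq> W"
  obtains \<delta> where "\<delta> \<in> W" "\<And>\<xi>. \<xi> \<in> X \<Longrightarrow> \<xi> \<prec> \<delta>"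
proof -
  have "countable (X \<union> (\<Union>\<xi>\<in>X. underS aleph1 \<xi>))"
    using assms(1) countable_underS_aleph1 by blast
  then obtain \<delta> where "\<delta> \<in> W" "\<delta> \<notin> X \<union> (\<Union>\<xi>\<in>X. underS aleph1 \<xi>)"
    using Field_aleph1_uncountable by (metis countable_subset subsetI)
  then show ?thesis using that[of \<delta>] less_W_linear assms(2) by blast
qed

definition positive :: "nat set set \<Rightarrow> bool" where
  "positive X \<longleftrightarrow> X \<subseteq> W \<and> X \<notin> I"

lemma positive_sets_iff: "X \<in> positive_sets aleph1 I \<longleftrightarrow> positive X"
  by (auto simp: positive_sets_def positive_def)

lemma ideal_over_I: "ideal_over aleph1 I"
  using weakly_laver by (simp add: weakly_laver_def)

lemma in_I_subset: "X \<in> I \<Longrightarrow> Y \<subseteq> X \<Longrightarrow> Y \<in> I"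
  using ideal_over_I unfolding ideal_over_def by metis

lemma W_notin_I: "W \<notin> I"
  using ideal_over_I by (simp add: ideal_over_def)

lemma bounded_in_I:
  assumes "\<delta> \<in> W" "X \<subseteq> W" "\<And>\<xi>. \<xi> \<in> X \<Longrightarrow> \<not> \<delta> \<prec> \<xi>"
  shows "X \<in> I"
proof -
  have "(\<xi>, \<delta>) \<in> aleph1" if "\<xi> \<in> X" for \<xi>
  proof (cases "\<xi> = \<delta>")
    case True
    then show ?thesis using assms(1) Well_order_aleph1
      by (auto simp: well_order_on_def linear_order_on_def partial_order_on_def preorder_on_def refl_on_def)
  next
    case False
    then show ?thesis using less_W_linear[of \<xi> \<delta>] assms that by (auto simp: underS_def)
  qed
  then have "bounded_in aleph1 X" using assms by (auto simp: bounded_in_def)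
  then show ?thesis using ideal_over_I by (simp add: ideal_over_def)
qed

lemma countable_Union_in_I:
  assumes "countable \<X>" "\<And>X. X \<in> \<X> \<Longrightarrow> X \<in> I"
  shows "\<Union>\<X> \<in> I"
  using weakly_laver assms countable_card_of_ordLess_aleph1[of \<X>]
  by (auto simp: weakly_laver_def complete_ideal_def)

lemma empty_in_I: "{} \<in> I"
  using countable_Union_in_I[of "{}"] by simp

lemma Un_in_I: "X \<in> I \<Longrightarrow> Y \<in> I \<Longrightarrow> X \<union> Y \<in> I"
  using countable_Union_in_I[of "{X, Y}"] by auto

lemma countable_UN_in_I:
  assumes "countable T" "\<And>t. t \<in> T \<Longrightarrow> X t \<in> I"
  shows "(\<Union>t\<in>T. X t) \<in> I"
  using assms by (intro countable_Union_in_I) auto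

section \<open>Consequences of saturation\<close>

lemma saturated:
  fixes A :: "nat set set \<Rightarrow> nat set set"
  assumes "\<And>\<alpha>. \<alpha> \<in> Field aleph2 \<Longrightarrow> positive (A \<alpha>)"
  obtains h :: "nat set \<Rightarrow> nat set set"
  where "inj_on h W" "h ` W \<subseteq> Field aleph2"
    "\<And>C. C \<subseteq> W \<Longrightarrow> |C| =o aleph0 \<Longrightarrow> positive (\<Inter>\<beta>\<in>C. A (h \<beta>))"
proof -
  have "saturated_ideal aleph1 aleph2 aleph1 aleph0 I"
    using weakly_laver by (simp add: weakly_laver_def)
  from this[unfolded saturated_ideal_def positive_sets_iff, THEN spec, of A] assms
  have "\<exists>h. inj_on h W \<and> h ` W \<subseteq> Field aleph2 \<and>
      (\<forall>C. C \<subseteq> W \<and> |C| =o aleph0 \<longrightarrow> positive (\<Inter>\<beta>\<in>C. A (h \<beta>)))"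
    by simp
  then show ?thesis using that by (elim exE conjE) simp
qed

lemma positive_superset: "positive X \<Longrightarrow> X \<subseteq> Y \<Longrightarrow> Y \<subseteq> W \<Longrightarrow> positive Y"
  using in_I_subset by (auto simp: positive_def)

text \<open>Among the uncountably many sets given by saturation, infinitely many have the same
  \<open>n\<close>. Saturation speaks of exactly countably infinite intersections, so a countably
  infinite subfamily is fixed first; the pair meets in a superset of its intersection.\<close>

lemma saturated_pair:
  fixes A :: "nat set set \<Rightarrow> nat set set" and n :: "nat set set \<Rightarrow> nat"
  assumes "\<And>\<alpha>. \<alpha> \<in> Field aleph2 \<Longrightarrow> positive (A \<alpha>)"
  obtains \<alpha> \<beta> where "\<alpha> \<in> Field aleph2" "\<beta> \<in> Field aleph2" "\<alpha> \<noteq> \<beta>" "n \<alpha> = n \<beta>"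
    "positive (A \<alpha> \<inter> A \<beta>)"
proof -
  obtain h :: "nat set \<Rightarrow> nat set set" where h: "inj_on h W" "h ` W \<subseteq> Field aleph2"
    and pos: "\<And>C. C \<subseteq> W \<Longrightarrow> |C| =o aleph0 \<Longrightarrow> positive (\<Inter>\<beta>\<in>C. A (h \<beta>))"
    using saturated[of A] assms by metis
  have "\<exists>k. infinite {\<xi> \<in> W. n (h \<xi>) = k}"
  proof (rule ccontr)
    assume "\<nexists>k. infinite {\<xi> \<in> W. n (h \<xi>) = k}"
    then have "countable (\<Union>k. {\<xi> \<in> W. n (h \<xi>) = k})"
      by (intro countable_UN) (auto intro: countable_finite)
    moreover have "W = (\<Union>k. {\<xi> \<in> W. n (h \<xi>) = k})" by auto
    ultimately show False using Field_aleph1_uncountable by simp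
  qed
  then obtain k where "infinite {\<xi> \<in> W. n (h \<xi>) = k}" by blast
  then obtain C where C: "C \<subseteq> {\<xi> \<in> W. n (h \<xi>) = k}" "|C| =o natLeq" "infinite C"
    using ex_infinite_countable_subset by blast
  obtain \<xi> where \<xi>: "\<xi> \<in> C" using C(3) by fastforce
  obtain \<eta> where \<eta>: "\<eta> \<in> C" "\<eta> \<noteq> \<xi>"
    using C(3) infinite_remove[of C \<xi>] by (metis Diff_iff ex_in_conv finite.emptyI insertI1)
  have "positive (\<Inter>\<beta>\<in>C. A (h \<beta>))" using pos C by auto
  moreover have "(\<Inter>\<beta>\<in>C. A (h \<beta>)) \<subseteq> A (h \<xi>) \<inter> A (h \<eta>)" using \<xi> \<eta> by auto
  moreover have hF: "h \<xi> \<in> Field aleph2" "h \<eta> \<in> Field aleph2" using h(2) C(1) \<xi> \<eta> by auto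
  moreover from this have "A (h \<xi>) \<inter> A (h \<eta>) \<subseteq> W" using assms by (auto simp: positive_def)
  ultimately have "positive (A (h \<xi>) \<inter> A (h \<eta>))" using positive_superset by blast
  moreover have "h \<xi> \<noteq> h \<eta>" using h(1) C(1) \<xi> \<eta> by (auto dest: inj_onD)
  ultimately show ?thesis using that[of "h \<xi>" "h \<eta>"] hF C(1) \<xi> \<eta> by auto
qed

text \<open>An antichain of size \<open>\<aleph>\<^sub>2\<close> would contradict
  \<open>saturated_pair\<close>. The injection serves to well-order an antichain so that each member
  has only countably many predecessors.\<close>

lemma antichain_inj_W:
  assumes "\<And>A. A \<in> \<A> \<Longrightarrow> positive A"
    and "\<And>A B. A \<in> \<A> \<Longrightarrow> B \<in> \<A> \<Longrightarrow> A \<noteq> B \<Longrightarrow> A \<inter> B \<in> I"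
  obtains i where "inj_on i \<A>" "i ` \<A> \<subseteq> W"
proof -
  have "|\<A>| \<le>o aleph1"
  proof (rule ccontr)
    assume "\<not> |\<A>| \<le>o aleph1"
    then have "aleph1 <o |\<A>|"
      by (simp add: not_ordLeq_iff_ordLess Well_order_aleph1 card_of_Well_order)
    then have "aleph2 \<le>o |\<A>|"
      using cardSuc_least[OF cardSuc_Card_order[OF natLeq_Card_order] card_of_Card_order] by blast
    then have "|Field aleph2| \<le>o |\<A>|"
      by (rule ordIso_ordLeq_trans[OF card_of_Field_ordIso[OF
            cardSuc_Card_order[OF cardSuc_Card_order[OF natLeq_Card_order]]]])
    then obtain A where A: "inj_on A (Field aleph2)" "A ` Field aleph2 \<subseteq> \<A>"
      by (auto simp: card_of_ordLeq[symmetric])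
    have mem: "A \<alpha> \<in> \<A>" if "\<alpha> \<in> Field aleph2" for \<alpha> using A(2) that by blast
    then have "positive (A \<alpha>)" if "\<alpha> \<in> Field aleph2" for \<alpha> using assms(1) that by simp
    then obtain \<alpha> \<beta> where \<alpha>\<beta>: "\<alpha> \<in> Field aleph2" "\<beta> \<in> Field aleph2" "\<alpha> \<noteq> \<beta>"
      and pos: "positive (A \<alpha> \<inter> A \<beta>)"
      using saturated_pair[of A "\<lambda>_. 0"] by metis
    have "A \<alpha> \<noteq> A \<beta>" using inj_onD[OF A(1) _ \<alpha>\<beta>(1,2)] \<alpha>\<beta>(3) by blast
    then have "A \<alpha> \<inter> A \<beta> \<in> I" by (intro assms(2) mem \<alpha>\<beta>)
    then show False using pos by (simp add: positive_def)
  qed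
  then have "|\<A>| \<le>o |W|"
    by (rule ordLeq_ordIso_trans[OF _ ordIso_symmetric[OF card_of_Field_ordIso[OF
            cardSuc_Card_order[OF natLeq_Card_order]]]])
  then show ?thesis using that by (auto simp: card_of_ordLeq[symmetric])
qed

text \<open>The fibres are null, so in a generic ultrapower below \<open>X\<close> the function
  \<open>h\<close> differs from every ground model countable ordinal and represents an ordinal at
  least \<open>\<omega>\<^sub>1\<close>.\<close>

definition small :: "(nat set \<Rightarrow> nat set) \<Rightarrow> nat set set \<Rightarrow> bool" where
  "small h X \<longleftrightarrow> X \<subseteq> W \<and> h ` X \<subseteq> W \<and> (\<forall>\<xi>\<in>W. {x \<in> X. h x = \<xi>} \<in> I)"

lemma small_subset:
  assumes "small h X" "Y \<subseteq> X"
  shows "small h Y"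
proof -
  have "{x \<in> Y. h x = \<xi>} \<in> I" if "\<xi> \<in> W" for \<xi>
  proof (rule in_I_subset)
    show "{x \<in> X. h x = \<xi>} \<in> I" using assms(1) that by (simp add: small_def)
  qed (use assms(2) in blast)
  then show ?thesis using assms unfolding small_def by (meson image_mono subset_trans)
qed

text \<open>Only countably many values are not above \<delta>, each with a null fibre, and the ideal
  is countably complete.\<close>

lemma small_bounded:
  assumes h: "small h X" and \<delta>: "\<delta> \<in> W"
  shows "{x \<in> X. \<not> \<delta> \<prec> h x} \<in> I"
proof (rule in_I_subset)
  show "(\<Union>\<eta>\<in>insert \<delta> (underS aleph1 \<delta>). {x \<in> X. h x = \<eta>}) \<in> I"
    using h less_W_Field(1) \<delta>
    by (intro countable_UN_in_I) (auto simp: small_def countable_underS_aleph1)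
  show "{x \<in> X. \<not> \<delta> \<prec> h x} \<subseteq> (\<Union>\<eta>\<in>insert \<delta> (underS aleph1 \<delta>). {x \<in> X. h x = \<eta>})"
  proof
    fix x assume x: "x \<in> {x \<in> X. \<not> \<delta> \<prec> h x}"
    then have "h x \<in> W" using h by (auto simp: small_def)
    then show "x \<in> (\<Union>\<eta>\<in>insert \<delta> (underS aleph1 \<delta>). {x \<in> X. h x = \<eta>})"
      using less_W_linear[OF \<delta>, of "h x"] x by auto
  qed
qed

text \<open>
  In the generic ultrapower: if no condition decides \<open>h\<close> to represent \<open>\<omega>\<^sub>1\<close>, mixing along a
  maximal antichain produces a function strictly below \<open>h\<close> almost everywhere.
\<close>

lemma descend:
  assumes h: "small h A" and A: "W - A \<in> I"
    and step: "\<And>B. positive B \<Longrightarrow> small h B \<Longrightarrow>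
      \<exists>C\<subseteq>B. positive C \<and> (\<exists>h'. small h' C \<and> (\<forall>x\<in>C. h' x \<prec> h x))"
  shows "\<exists>h' A'. A' \<subseteq> A \<and> W - A' \<in> I \<and> small h' A' \<and> (\<forall>x\<in>A'. h' x \<prec> h x)"
proof -
  \<comment> \<open>\<open>Q\<close> collects the conditions below \<open>A\<close> that already
    have a function below \<open>h\<close>; \<open>ac\<close> singles out the families in
    \<open>Q\<close> that are antichains modulo \<open>I\<close>.\<close>
  define Q where "Q = {B. B \<subseteq> A \<and> positive B \<and> (\<exists>h'. small h' B \<and> (\<forall>x\<in>B. h' x \<prec> h x))}"
  define ac where "ac \<A> \<longleftrightarrow> \<A> \<subseteq> Q \<and> (\<forall>B\<in>\<A>. \<forall>C\<in>\<A>. B \<noteq> C \<longrightarrow> B \<inter> C \<in> I)" for \<A>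
  have "\<exists>\<A>\<in>Collect ac. \<forall>\<B>\<in>Collect ac. \<A> \<subseteq> \<B> \<longrightarrow> \<B> = \<A>"
  proof (rule subset_Zorn')
    fix \<C> assume "subset.chain (Collect ac) \<C>"
    then have ch: "\<And>\<A>. \<A> \<in> \<C> \<Longrightarrow> ac \<A>" "\<And>\<A> \<B>. \<A> \<in> \<C> \<Longrightarrow> \<B> \<in> \<C> \<Longrightarrow> \<A> \<subseteq> \<B> \<or> \<B> \<subseteq> \<A>"
      by (auto simp: subset_chain_def)
    have "B \<inter> C \<in> I" if BC: "B \<in> \<Union>\<C>" "C \<in> \<Union>\<C>" "B \<noteq> C" for B C
    proof -
      obtain \<A> \<B> where "\<A> \<in> \<C>" "\<B> \<in> \<C>" "B \<in> \<A>" "C \<in> \<B>" using BC by blast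
      then show ?thesis using ch BC(3) unfolding ac_def by (meson subsetD)
    qed
    moreover have "\<Union>\<C> \<subseteq> Q" using ch(1) by (force simp: ac_def)
    ultimately show "\<Union>\<C> \<in> Collect ac" by (simp add: ac_def)
  qed
  then obtain \<A> where ac: "ac \<A>" and max: "\<And>\<B>. ac \<B> \<Longrightarrow> \<A> \<subseteq> \<B> \<Longrightarrow> \<B> = \<A>" by blast
  \<comment> \<open>Otherwise \<open>step\<close> would find inside \<open>B\<close> a condition
    that could be added to the maximal antichain.\<close>
  have maximal: "\<exists>C\<in>\<A>. positive (B \<inter> C)" if B: "positive B" "B \<subseteq> A" for B
  proof (rule ccontr)
    assume "\<not> (\<exists>C\<in>\<A>. positive (B \<inter> C))"
    then have no: "B \<inter> C \<in> I" if "C \<in> \<A>" for C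
      using B that by (auto simp: positive_def)
    obtain D f where Df: "D \<subseteq> B" "positive D" "small f D" "\<forall>x\<in>D. f x \<prec> h x"
      using step[OF B(1) small_subset[OF h B(2)]] by metis
    from Df(1) B(2) have "D \<subseteq> A" by (rule subset_trans)
    with Df(2-4) have DQ: "D \<in> Q" unfolding Q_def mem_Collect_eq by (intro conjI exI[of _ f])
    have DC: "D \<inter> C \<in> I" if "C \<in> \<A>" for C
      by (rule in_I_subset[OF no[OF that]]) (use Df(1) in blast)
    then have "ac (insert D \<A>)" using ac DQ by (auto simp: ac_def Int_commute)
    then have "D \<in> \<A>" using max by blast
    then show False using DC[of D] Df(2) by (simp add: positive_def)
  qed
  obtain i where i: "inj_on i \<A>" "i ` \<A> \<subseteq> W"
    using antichain_inj_W[of \<A>] ac by (auto simp: ac_def Q_def)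
  obtain f where f: "\<And>B. B \<in> \<A> \<Longrightarrow> small (f B) B" "\<And>B x. B \<in> \<A> \<Longrightarrow> x \<in> B \<Longrightarrow> f B x \<prec> h x"
  proof -
    have "\<forall>B\<in>\<A>. \<exists>h'. small h' B \<and> (\<forall>x\<in>B. h' x \<prec> h x)"
    proof
      fix B assume "B \<in> \<A>"
      then have "B \<in> Q" using ac by (auto simp: ac_def)
      then show "\<exists>h'. small h' B \<and> (\<forall>x\<in>B. h' x \<prec> h x)" by (simp add: Q_def)
    qed
    from bchoice[OF this] show ?thesis using that by blast
  qed
  \<comment> \<open>Members of the antichain may overlap in null sets, so each point is assigned to
    the member of least index containing it.\<close>
  have "\<forall>x\<in>\<Union>\<A>. \<exists>B\<in>\<A>. x \<in> B \<and> (\<forall>C\<in>\<A>. x \<in> C \<longrightarrow> \<not> i C \<prec> i B)"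
  proof
    fix x assume "x \<in> \<Union>\<A>"
    then have "i ` {B \<in> \<A>. x \<in> B} \<noteq> {}" by auto
    from wfE_min'[OF wf_less_W this] obtain z where z: "z \<in> i ` {B \<in> \<A>. x \<in> B}"
      and z_min: "\<And>y. (y, z) \<in> aleph1 - Id \<Longrightarrow> y \<notin> i ` {B \<in> \<A>. x \<in> B}" by blast
    obtain B where "B \<in> \<A>" "x \<in> B" "z = i B" using z by blast
    then show "\<exists>B\<in>\<A>. x \<in> B \<and> (\<forall>C\<in>\<A>. x \<in> C \<longrightarrow> \<not> i C \<prec> i B)"
      using z_min[of "i C" for C] by (intro bexI[of _ B]) (auto simp: underS_def)
  qed
  from bchoice[OF this[unfolded Bex_def]]
  obtain s where s: "\<And>x. x \<in> \<Union>\<A> \<Longrightarrow> s x \<in> \<A>" "\<And>x. x \<in> \<Union>\<A> \<Longrightarrow> x \<in> s x"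
    "\<And>x C. x \<in> \<Union>\<A> \<Longrightarrow> C \<in> \<A> \<Longrightarrow> x \<in> C \<Longrightarrow> \<not> i C \<prec> i (s x)"
    by blast
  define h' where "h' x = f (s x) x" for x
  have sub: "\<Union>\<A> \<subseteq> A" using ac by (auto simp: ac_def Q_def)
  have AW: "A \<subseteq> W" using h by (simp add: small_def)
  have less: "h' x \<prec> h x" if "x \<in> \<Union>\<A>" for x using f s that by (simp add: h'_def)
  \<comment> \<open>On a member \<open>C\<close>, the mixed function agrees with \<open>f C\<close>
    except at points of earlier members. There are countably many of these, each meeting
    \<open>C\<close> in a null set.\<close>
  have fibre: "{x \<in> \<Union>\<A>. h' x = \<zeta>} \<in> I" (is "?F \<in> I") if \<zeta>: "\<zeta> \<in> W" for \<zeta>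
  proof (rule ccontr)
    assume "?F \<notin> I"
    then obtain C where C: "C \<in> \<A>" "positive (?F \<inter> C)"
      using maximal[of ?F] sub AW by (auto simp: positive_def)
    have "?F \<inter> C \<subseteq> {x \<in> C. f C x = \<zeta>} \<union> (\<Union>D\<in>{D \<in> \<A>. i D \<prec> i C}. D \<inter> C)"
    proof
      fix x assume x: "x \<in> ?F \<inter> C"
      then have sx: "s x \<in> \<A>" "x \<in> s x" "\<not> i C \<prec> i (s x)" using s C(1) by blast+
      show "x \<in> {x \<in> C. f C x = \<zeta>} \<union> (\<Union>D\<in>{D \<in> \<A>. i D \<prec> i C}. D \<inter> C)"
      proof (cases "s x = C")
        case True
        then show ?thesis using x by (simp add: h'_def)
      next
        case False
        then have "i (s x) \<prec> i C"
          using less_W_linear[of "i (s x)" "i C"] i sx C(1) by (auto dest: inj_onD)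
        then show ?thesis using x sx by blast
      qed
    qed
    moreover have "{x \<in> C. f C x = \<zeta>} \<in> I" using f(1)[OF C(1)] \<zeta> by (simp add: small_def)
    moreover have "(\<Union>D\<in>{D \<in> \<A>. i D \<prec> i C}. D \<inter> C) \<in> I"
    proof (rule countable_UN_in_I)
      have "i ` {D \<in> \<A>. i D \<prec> i C} \<subseteq> underS aleph1 (i C)" by auto
      then have "countable (i ` {D \<in> \<A>. i D \<prec> i C})"
        using countable_underS_aleph1 countable_subset by blast
      moreover have "inj_on i {D \<in> \<A>. i D \<prec> i C}" using i(1) by (rule inj_on_subset) blast
      ultimately show "countable {D \<in> \<A>. i D \<prec> i C}" by (rule countable_image_inj_on)
      fix D assume "D \<in> {D \<in> \<A>. i D \<prec> i C}"
      then have "D \<in> \<A>" "D \<noteq> C" using less_W_irrefl by auto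
      then show "D \<inter> C \<in> I" using ac C(1) by (auto simp: ac_def)
    qed
    ultimately have "?F \<inter> C \<in> I" by (meson in_I_subset Un_in_I)
    then show False using C(2) by (simp add: positive_def)
  qed
  have "W - \<Union>\<A> \<in> I"
  proof -
    have "A - \<Union>\<A> \<in> I"
    proof (rule ccontr)
      assume "A - \<Union>\<A> \<notin> I"
      then obtain C where "C \<in> \<A>" "positive ((A - \<Union>\<A>) \<inter> C)"
        using maximal[of "A - \<Union>\<A>"] AW by (auto simp: positive_def)
      moreover from this have "(A - \<Union>\<A>) \<inter> C = {}" by blast
      ultimately show False using empty_in_I by (simp add: positive_def)
    qed
    then have "(W - A) \<union> (A - \<Union>\<A>) \<in> I" using A Un_in_I by blast
    then show ?thesis by (rule in_I_subset) blast
  qed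
  moreover have "small h' (\<Union>\<A>)"
    unfolding small_def
  proof (intro conjI ballI)
    show "\<Union>\<A> \<subseteq> W" using sub AW by (rule subset_trans)
    show "h' ` \<Union>\<A> \<subseteq> W" using less less_W_Field(1) by auto
  qed (rule fibre)
  ultimately show ?thesis using sub less by (intro exI[of _ h'] exI[of _ "\<Union>\<A>"]) auto
qed

text \<open>On \<open>A\<close>, the function \<open>h\<close> represents \<open>\<omega>\<^sub>1\<close>, so its projection of the ideal is normal.\<close>

lemma ex_normal_function:
  obtains h A where "positive A" "small h A"
    "\<And>g. g ` W \<subseteq> W \<Longrightarrow> {x \<in> A. \<exists>\<xi>. \<xi> \<prec> h x \<and> \<not> g \<xi> \<prec> h x} \<in> I"
proof (rule ccontr)
  assume neg: "\<not> thesis"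
  note main = that
  \<comment> \<open>If closure under \<open>g\<close> fails on a positive set, choose
    \<open>h' x\<close> below \<open>h x\<close> with \<open>g (h' x)\<close> not below
    \<open>h x\<close>. A fibre of \<open>h'\<close> over \<zeta> then has \<open>h x\<close>
    bounded by \<open>g \<zeta>\<close> and is null.\<close>
  have step: "\<exists>C\<subseteq>B. positive C \<and> (\<exists>h'. small h' C \<and> (\<forall>x\<in>C. h' x \<prec> h x))"
    if B: "positive B" "small h B" for h B
  proof -
    obtain g where g: "g ` W \<subseteq> W" and "{x \<in> B. \<exists>\<xi>. \<xi> \<prec> h x \<and> \<not> g \<xi> \<prec> h x} \<notin> I"
      using neg main[OF B] by blast
    moreover define C where "C = {x \<in> B. \<exists>\<xi>. \<xi> \<prec> h x \<and> \<not> g \<xi> \<prec> h x}"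
    ultimately have C: "positive C" using B by (auto simp: positive_def)
    obtain h' where h': "\<And>x. x \<in> C \<Longrightarrow> h' x \<prec> h x" "\<And>x. x \<in> C \<Longrightarrow> \<not> g (h' x) \<prec> h x"
    proof -
      have "\<forall>x\<in>C. \<exists>\<xi>. \<xi> \<prec> h x \<and> \<not> g \<xi> \<prec> h x" by (simp add: C_def)
      from bchoice[OF this] show ?thesis using that by blast
    qed
    have "{x \<in> C. h' x = \<zeta>} \<in> I" if \<zeta>: "\<zeta> \<in> W" for \<zeta>
    proof (rule in_I_subset)
      show "{x \<in> B. \<not> g \<zeta> \<prec> h x} \<in> I" using g \<zeta> by (intro small_bounded B(2)) blast
      show "{x \<in> C. h' x = \<zeta>} \<subseteq> {x \<in> B. \<not> g \<zeta> \<prec> h x}" using h'(2) by (auto simp: C_def)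
    qed
    moreover have "h' ` C \<subseteq> W" using h'(1) less_W_Field(1) by auto
    ultimately have "small h' C" using C by (simp add: small_def positive_def)
    moreover have "C \<subseteq> B" by (auto simp: C_def)
    ultimately show ?thesis using C h'(1) by blast
  qed
  define P where "P = (\<lambda>(h, A). small h A \<and> W - A \<in> I)"
  \<comment> \<open>The descent starts at the identity, whose fibres are bounded because they are
    singletons.\<close>
  have "P (id, W)"
  proof -
    have "{x \<in> W. id x = \<xi>} \<in> I" if "\<xi> \<in> W" for \<xi>
      using that less_W_irrefl by (intro bounded_in_I[of \<xi>]) auto
    then show ?thesis using empty_in_I by (simp add: P_def small_def)
  qed
  moreover have "\<exists>q. P q \<and> (\<forall>x\<in>snd q. x \<in> snd p \<and> fst q x \<prec> fst p x)" if "P p" for p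
  proof -
    obtain h A where p: "p = (h, A)" by fastforce
    have "small h A" "W - A \<in> I" using that by (simp_all add: P_def p)
    then obtain h' A' where "A' \<subseteq> A" "W - A' \<in> I" "small h' A'" "\<forall>x\<in>A'. h' x \<prec> h x"
      using descend[OF _ _ step] by metis
    then show ?thesis by (intro exI[of _ "(h', A')"]) (auto simp: P_def p)
  qed
  ultimately have "\<exists>f :: nat \<Rightarrow> _. \<forall>n. P (f n) \<and>
      (\<forall>x\<in>snd (f (Suc n)). x \<in> snd (f n) \<and> fst (f (Suc n)) x \<prec> fst (f n) x)"
    using dependent_nat_choice[of "\<lambda>_. P"
        "\<lambda>_ p q. \<forall>x\<in>snd q. x \<in> snd p \<and> fst q x \<prec> fst p x"] by metis
  then obtain f :: "nat \<Rightarrow> _" where f: "\<And>n. P (f n)"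
    "\<And>n x. x \<in> snd (f (Suc n)) \<Longrightarrow> x \<in> snd (f n) \<and> fst (f (Suc n)) x \<prec> fst (f n) x" by blast
  \<comment> \<open>By countable completeness one point survives all stages; the values there would
    decrease forever in \<open>\<omega>\<^sub>1\<close>.\<close>
  have "(\<Union>n. W - snd (f n)) \<in> I"
    using f(1) by (intro countable_UN_in_I) (auto simp: P_def split_beta)
  then obtain x where "x \<in> W" "x \<notin> (\<Union>n. W - snd (f n))"
    using W_notin_I in_I_subset by (metis subsetI)
  then have "\<And>n. x \<in> snd (f n)" by blast
  then have down: "\<And>n. (fst (f (Suc n)) x, fst (f n) x) \<in> aleph1 - Id"
    using f(2) by (force simp: underS_def)
  show False
    by (rule wf_no_infinite_down_chainE[OF wf_less_W, of "\<lambda>n. fst (f n) x"]) (use down in simp)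
qed

end

section \<open>Specializing trees\<close>

text \<open>Martin's axiom is given for one type only. The poset is copied into that type along an
  injection, and the filter obtained there is pulled back.\<close>

lemma martins_axiom_transfer:
  fixes P :: "'q set" and le :: "'q rel"
  assumes MA: "martins_axiom TYPE('p)"
    and card: "|P| \<le>o |UNIV :: 'p set|"
    and P: "P \<noteq> {}" "partial_order_on P le" "ccc P le"
    and \<D>: "|\<D>| <o continuum" "\<And>D. D \<in> \<D> \<Longrightarrow> dense_in P le D"
  obtains G where "filter_in P le G" "\<And>D. D \<in> \<D> \<Longrightarrow> G \<inter> D \<noteq> {}"
proof -
  obtain f :: "'q \<Rightarrow> 'p" where f: "inj_on f P" using card by (auto simp: card_of_ordLeq[symmetric])
  define le' where "le' = map_prod f f ` le"
  have leP: "le \<subseteq> P \<times> P" and rfl: "\<And>p. p \<in> P \<Longrightarrow> (p, p) \<in> le" and tr: "trans le" and an: "antisym le"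
    using P(2) by (auto simp: partial_order_on_def preorder_on_def refl_on_def)
  have le'[simp]: "(f p, f q) \<in> le' \<longleftrightarrow> (p, q) \<in> le" if "p \<in> P" "q \<in> P" for p q
    using f leP that by (auto simp: le'_def dest: inj_onD)
  have "partial_order_on (f ` P) le'"
    unfolding partial_order_on_def preorder_on_def
  proof (intro conjI)
    show le'P: "le' \<subseteq> f ` P \<times> f ` P" using leP by (auto simp: le'_def)
    show "refl_on (f ` P) le'" using rfl by (auto simp: refl_on_def)
    show "trans le'"
    proof (rule transI)
      fix x y z assume *: "(x, y) \<in> le'" "(y, z) \<in> le'"
      then obtain p q r where "x = f p" "y = f q" "z = f r" "p \<in> P" "q \<in> P" "r \<in> P"
        using le'P by blast
      then show "(x, z) \<in> le'" using * tr by (auto dest: transD)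
    qed
    show "antisym le'"
    proof (rule antisymI)
      fix x y assume *: "(x, y) \<in> le'" "(y, x) \<in> le'"
      then obtain p q where "x = f p" "y = f q" "p \<in> P" "q \<in> P" using le'P by blast
      then show "x = y" using * an by (auto dest: antisymD)
    qed
  qed
  moreover have "ccc (f ` P) le'"
    unfolding ccc_def
  proof (intro allI impI)
    fix A assume A: "antichain (f ` P) le' A"
    then obtain B where B: "B \<subseteq> P" "A = f ` B" by (auto simp: antichain_def subset_image_iff)
    have "antichain P le B"
      unfolding antichain_def
    proof (intro conjI ballI impI notI)
      show "B \<subseteq> P" by fact
      fix p q assume pq: "p \<in> B" "q \<in> B" "p \<noteq> q" "compatible P le p q"
      then obtain s where "s \<in> P" "(s, p) \<in> le" "(s, q) \<in> le" by (auto simp: compatible_def)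
      then have "compatible (f ` P) le' (f p) (f q)"
        unfolding compatible_def using B pq(1,2) by (intro bexI[of _ "f s"]) auto
      moreover have "f p \<noteq> f q" using pq f B by (auto dest: inj_onD)
      ultimately show False using A pq B by (auto simp: antichain_def)
    qed
    then show "countable A" using P(3) B(2) by (auto simp: ccc_def)
  qed
  moreover have "|(`) f ` \<D>| <o continuum"
    using card_of_image \<D>(1) ordLeq_ordLess_trans by blast
  moreover have "dense_in (f ` P) le' (f ` D)" if "D \<in> \<D>" for D
    using \<D>(2)[OF that] unfolding dense_in_def by (fastforce simp: subset_iff)
  ultimately have "\<exists>G. filter_in (f ` P) le' G \<and> (\<forall>D\<in>(`) f ` \<D>. G \<inter> D \<noteq> {})"
    using P(1) by (intro MA[unfolded martins_axiom_def, rule_format]) auto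
  then obtain G' where G': "filter_in (f ` P) le' G'"
    and meets: "\<forall>D\<in>(`) f ` \<D>. G' \<inter> D \<noteq> {}" by (elim exE conjE)
  define G where "G = {p \<in> P. f p \<in> G'}"
  have "G' \<subseteq> f ` P" using G' by (simp add: filter_in_def)
  then have G'_eq: "G' = f ` G" by (auto simp: G_def)
  have GP: "G \<subseteq> P" by (auto simp: G_def)
  have "filter_in P le G"
    unfolding filter_in_def
  proof (intro conjI ballI impI)
    show "G \<noteq> {}" using G' G'_eq by (auto simp: filter_in_def)
    fix p q assume "p \<in> G" "q \<in> P" "(p, q) \<in> le"
    moreover from this have "(f p, f q) \<in> le'" using GP by auto
    ultimately show "q \<in> G" using G' unfolding filter_in_def G_def by blast
  next
    fix p q assume pq: "p \<in> G" "q \<in> G"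
    then have "\<exists>s\<in>G'. (s, f p) \<in> le' \<and> (s, f q) \<in> le'"
      using G' unfolding filter_in_def G_def by blast
    then obtain s where "s \<in> G" "(f s, f p) \<in> le'" "(f s, f q) \<in> le'" unfolding G'_eq by blast
    moreover from this pq have "s \<in> P" "p \<in> P" "q \<in> P" using GP by blast+
    ultimately show "\<exists>s\<in>G. (s, p) \<in> le \<and> (s, q) \<in> le" by (intro bexI[of _ s]) simp_all
  qed (use GP in auto)
  moreover have "G \<inter> D \<noteq> {}" if D: "D \<in> \<D>" for D
  proof -
    have "D \<subseteq> P" using \<D>(2)[OF D] by (simp add: dense_in_def)
    obtain d where "d \<in> D" "f d \<in> G'" using meets D by blast
    then show ?thesis using \<open>D \<subseteq> P\<close> by (auto simp: G_def)
  qed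
  ultimately show ?thesis by (rule that[of G])
qed

lemma card_of_Fpow_ordLeq:
  assumes "infinite A"
  shows "|Fpow A| \<le>o |A|"
proof -
  define F where "F n = {X. X \<subseteq> A \<and> finite X \<and> card X = n}" for n
  have "|F n| \<le>o |A|" for n
  proof (induction n)
    case 0
    have "F 0 = {{}}" by (auto simp: F_def)
    moreover have "A \<noteq> {}" using assms by auto
    ultimately show ?case using card_of_singl_ordLeq by metis
  next
    case (Suc n)
    have "X \<in> (\<lambda>(a, Y). insert a Y) ` (A \<times> F n)" if "X \<in> F (Suc n)" for X
    proof -
      obtain a Y where "X = insert a Y" "a \<notin> Y" "card Y = n" "finite Y"
        using \<open>X \<in> F (Suc n)\<close> by (auto simp: F_def card_Suc_eq_finite)
      then show ?thesis using that by (intro image_eqI[of _ _ "(a, Y)"]) (auto simp: F_def)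
    qed
    then have "|F (Suc n)| \<le>o |A \<times> F n|"
      by (meson card_of_image card_of_mono1 ordLeq_transitive subsetI)
    moreover have "|A \<times> F n| \<le>o |A|"
    proof (cases "F n = {}")
      case False
      then show ?thesis using card_of_Times_infinite[OF assms False Suc] ordIso_imp_ordLeq by blast
    qed (simp add: card_of_empty)
    ultimately show ?case by (rule ordLeq_transitive)
  qed
  then have "|\<Union>n. F n| \<le>o |A|"
    using assms by (intro card_of_UNION_ordLeq_infinite) (auto simp: infinite_iff_card_of_nat)
  moreover have "Fpow A = (\<Union>n. F n)" by (auto simp: Fpow_def F_def)
  ultimately show ?thesis by simp
qed

text \<open>Take a maximal family whose finite intersections are uncountable in \<open>X\<close>. A
  set outside it meets some finite intersection in a countable set; if all sets of a finite cover
  were outside, combining these intersections would give a countable one.\<close>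

lemma ex_uniform_ultrafilter:
  assumes "uncountable X"
  obtains \<U> where
    "\<And>F. finite F \<Longrightarrow> F \<subseteq> \<U> \<Longrightarrow> uncountable (X \<inter> \<Inter>F)"
    "\<And>T Y. finite T \<Longrightarrow> countable (X - (\<Union>t\<in>T. Y t)) \<Longrightarrow> \<exists>t\<in>T. Y t \<in> \<U>"
proof -
  define fip where "fip \<U> \<longleftrightarrow> (\<forall>F. finite F \<and> F \<subseteq> \<U> \<longrightarrow> uncountable (X \<inter> \<Inter>F))" for \<U>
  have "\<exists>\<U>\<in>Collect fip. \<forall>\<V>\<in>Collect fip. \<U> \<subseteq> \<V> \<longrightarrow> \<V> = \<U>"
  proof (rule subset_Zorn')
    fix \<C> assume ch: "subset.chain (Collect fip) \<C>"
    have "uncountable (X \<inter> \<Inter>F)" if F: "finite F" "F \<subseteq> \<Union>\<C>" for F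
    proof (cases "\<C> = {}")
      case True
      then show ?thesis using F assms by auto
    next
      case False
      then obtain \<U> where "\<U> \<in> \<C>" "F \<subseteq> \<U>"
        using finite_subset_Union_chain[OF F False] ch by blast
      then show ?thesis using ch F(1) by (auto simp: subset_chain_def fip_def)
    qed
    then show "\<Union>\<C> \<in> Collect fip" by (auto simp: fip_def)
  qed
  then obtain \<U> where \<U>: "fip \<U>" and max: "\<And>\<V>. fip \<V> \<Longrightarrow> \<U> \<subseteq> \<V> \<Longrightarrow> \<V> = \<U>" by blast
  have small: "\<exists>F. finite F \<and> F \<subseteq> \<U> \<and> countable (X \<inter> \<Inter>F \<inter> Y)" if "Y \<notin> \<U>" for Y
  proof -
    have "\<not> fip (insert Y \<U>)" using max that by blast
    then obtain F where F: "finite F" "F \<subseteq> insert Y \<U>" "countable (X \<inter> \<Inter>F)"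
      by (auto simp: fip_def)
    have "X \<inter> \<Inter>(F - {Y}) \<inter> Y \<subseteq> X \<inter> \<Inter>F" by blast
    then have "countable (X \<inter> \<Inter>(F - {Y}) \<inter> Y)" using F(3) countable_subset by blast
    then show ?thesis using F(1,2) by (intro exI[of _ "F - {Y}"]) auto
  qed
  have "\<exists>t\<in>T. Y t \<in> \<U>" if T: "finite T" "countable (X - (\<Union>t\<in>T. Y t))" for T and Y :: "'b \<Rightarrow> _"
  proof (rule ccontr)
    assume "\<not> (\<exists>t\<in>T. Y t \<in> \<U>)"
    then have "\<forall>t\<in>T. \<exists>F. finite F \<and> F \<subseteq> \<U> \<and> countable (X \<inter> \<Inter>F \<inter> Y t)" using small by blast
    from bchoice[OF this] obtain F where
      F: "\<forall>t\<in>T. finite (F t) \<and> F t \<subseteq> \<U> \<and> countable (X \<inter> \<Inter>(F t) \<inter> Y t)" by blast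
    have "finite (\<Union>t\<in>T. F t)" "(\<Union>t\<in>T. F t) \<subseteq> \<U>" using F T(1) by auto
    then have "uncountable (X \<inter> \<Inter>(\<Union>t\<in>T. F t))" using \<U> by (auto simp: fip_def)
    moreover have "X \<inter> \<Inter>(\<Union>t\<in>T. F t) \<subseteq> (X - (\<Union>t\<in>T. Y t)) \<union> (\<Union>t\<in>T. X \<inter> \<Inter>(F t) \<inter> Y t)"
      by auto
    moreover have "countable ((X - (\<Union>t\<in>T. Y t)) \<union> (\<Union>t\<in>T. X \<inter> \<Inter>(F t) \<inter> Y t))"
      using T F by (auto intro: countable_finite)
    ultimately show False using countable_subset by blast
  qed
  then show ?thesis using that[of \<U>] \<U> by (auto simp: fip_def)
qed


text \<open>Conditions are finite relations between points and colours, so a point may receive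
  several colours; \<open>conflict lt p p\<close> is what disqualifies \<open>p\<close> as a
  condition.\<close>

definition conflict :: "('a \<Rightarrow> 'a \<Rightarrow> bool) \<Rightarrow> ('a \<times> nat) set \<Rightarrow> ('a \<times> nat) set \<Rightarrow> bool" where
  "conflict lt p q \<longleftrightarrow> (\<exists>a b m. (a, m) \<in> p \<and> (b, m) \<in> q \<and> (lt a b \<or> lt b a))"

text \<open>
  An element lying in uncountably many conditions can be removed from all of them, which replaces
  the \<open>\<Delta>\<close>-system lemma. Otherwise, for each condition \<open>p\<close> almost all \<open>q\<close> in a uniform ultrafilter have
  their \<open>j\<close>-th point above the \<open>i\<close>-th point of \<open>p\<close>, for some \<open>i, j\<close>; the \<open>i\<close>-th points of all \<open>p\<close> with
  the same \<open>i, j\<close> form an uncountable chain.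
\<close>

lemma countable_conflict_family:
  fixes S :: "'a set" and lt :: "'a \<Rightarrow> 'a \<Rightarrow> bool"
  assumes lin: "\<And>a b c. a \<in> S \<Longrightarrow> b \<in> S \<Longrightarrow> c \<in> S \<Longrightarrow> lt a c \<Longrightarrow> lt b c \<Longrightarrow> a = b \<or> lt a b \<or> lt b a"
    and pred: "\<And>c. c \<in> S \<Longrightarrow> countable {a \<in> S. lt a c}"
    and chain: "\<And>X. X \<subseteq> S \<Longrightarrow> \<forall>a\<in>X. \<forall>b\<in>X. a \<noteq> b \<longrightarrow> lt a b \<or> lt b a \<Longrightarrow> countable X"
    and \<A>: "\<And>p. p \<in> \<A> \<Longrightarrow> finite p \<and> p \<subseteq> S \<times> UNIV \<and> card p = n \<and> \<not> conflict lt p p"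
    and conf: "\<And>p q. p \<in> \<A> \<Longrightarrow> q \<in> \<A> \<Longrightarrow> p \<noteq> q \<Longrightarrow> conflict lt p q"
  shows "countable \<A>"
  using \<A> conf
proof (induction n arbitrary: \<A>)
  case 0
  then have "p = {}" if "p \<in> \<A>" for p using that by (metis card_0_eq)
  then have "\<A> \<subseteq> {{}}" by blast
  then show ?case by (meson countable_empty countable_insert countable_subset)
next
  case (Suc n)
  note \<A> = Suc.prems(1) and conf = Suc.prems(2)
  \<comment> \<open>The pair \<open>z\<close> cannot take part in a conflict of two sets that both
    contain it, since one of them would then conflict with itself. Removing \<open>z\<close> thus
    keeps all conflicts and lowers the size.\<close>
  have few: "countable {p \<in> \<A>. z \<in> p}" (is "countable ?Z") for z
  proof -
    have "countable ((\<lambda>p. p - {z}) ` ?Z)"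
    proof (rule Suc.IH)
      fix p assume "p \<in> (\<lambda>p. p - {z}) ` ?Z"
      then obtain p' where p': "p = p' - {z}" "p' \<in> \<A>" "z \<in> p'" by blast
      then show "finite p \<and> p \<subseteq> S \<times> UNIV \<and> card p = n \<and> \<not> conflict lt p p"
        using \<A>[OF p'(2)] by (auto simp: conflict_def)
      fix q assume "q \<in> (\<lambda>p. p - {z}) ` ?Z" "p \<noteq> q"
      then obtain q' where q': "q = q' - {z}" "q' \<in> \<A>" "z \<in> q'" "p' \<noteq> q'" using p' by blast
      obtain a b m where ab: "(a, m) \<in> p'" "(b, m) \<in> q'" "lt a b \<or> lt b a"
        using conf[OF p'(2) q'(2,4)] by (auto simp: conflict_def)
      have "(a, m) \<noteq> z" using \<A>[OF q'(2)] q'(3) ab unfolding conflict_def by blast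
      moreover have "(b, m) \<noteq> z" using \<A>[OF p'(2)] p'(3) ab unfolding conflict_def by blast
      ultimately show "conflict lt p q" using ab p'(1) q'(1) unfolding conflict_def by blast
    qed
    moreover have "inj_on (\<lambda>p. p - {z}) ?Z" by (rule inj_onI) blast
    ultimately show ?thesis by (rule countable_image_inj_on)
  qed
  show ?case
  proof (rule ccontr)
    assume unc: "uncountable \<A>"
    have "\<forall>p\<in>\<A>. \<exists>e. e ` {..<Suc n} = p"
    proof
      fix p assume "p \<in> \<A>"
      then have "finite p" "card p = Suc n" using \<A> by blast+
      then show "\<exists>e. e ` {..<Suc n} = p"
        using ex_bij_betw_nat_finite[of p] by (auto simp: bij_betw_def atLeast0LessThan)
    qed
    from bchoice[OF this] obtain e where e: "\<And>p. p \<in> \<A> \<Longrightarrow> e p ` {..<Suc n} = p" by blast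
    define T where "T = {..<Suc n} \<times> {..<Suc n}"
    have "finite T" by (simp add: T_def)
    define Y where "Y p = (\<lambda>(i, j). {q \<in> \<A>. lt (fst (e p i)) (fst (e q j))})" for p
    obtain \<U> where \<U>: "\<And>F. finite F \<Longrightarrow> F \<subseteq> \<U> \<Longrightarrow> uncountable (\<A> \<inter> \<Inter>F)"
      "\<And>T :: (nat \<times> nat) set. \<And>Y. finite T \<Longrightarrow> countable (\<A> - (\<Union>t\<in>T. Y t)) \<Longrightarrow> \<exists>t\<in>T. Y t \<in> \<U>"
      using ex_uniform_ultrafilter[OF unc] by blast
    have "\<forall>p\<in>\<A>. \<exists>t\<in>T. Y p t \<in> \<U>"
    proof
      fix p assume p: "p \<in> \<A>"
      \<comment> \<open>If \<open>q\<close> is in no \<open>Y p t\<close>, its conflict with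
        \<open>p\<close> must place a point of \<open>q\<close> below a point of \<open>p\<close> of
        the same colour. By \<open>pred\<close> and \<open>few\<close> this leaves countably many
        \<open>q\<close>.\<close>
      let ?B = "insert p (\<Union>z\<in>p. \<Union>b\<in>{b \<in> S. lt b (fst z)}. {q \<in> \<A>. (b, snd z) \<in> q})"
      have "fst z \<in> S" if "z \<in> p" for z using \<A>[OF p] that by auto
      then have "countable ?B" using \<A>[OF p] few pred by (auto intro: countable_finite)
      moreover have "\<A> - (\<Union>t\<in>T. Y p t) \<subseteq> ?B"
      proof
        fix q assume q: "q \<in> \<A> - (\<Union>t\<in>T. Y p t)"
        show "q \<in> ?B"
        proof (cases "q = p")
          case False
          then obtain a b m where ab: "(a, m) \<in> p" "(b, m) \<in> q" "lt a b \<or> lt b a"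
            using conf[OF p, of q] q unfolding conflict_def by blast
          have "(a, m) \<in> e p ` {..<Suc n}" "(b, m) \<in> e q ` {..<Suc n}" using ab p q e by auto
          then obtain i j where "e p i = (a, m)" "e q j = (b, m)" "(i, j) \<in> T" by (fastforce simp: T_def)
          then have "\<not> lt a b" using q by (force simp: Y_def)
          then have "lt b a" using ab(3) by blast
          moreover have "b \<in> S" using \<A>[of q] q ab(2) by auto
          ultimately show ?thesis
            using ab q by (intro insertI2 UN_I[of "(a, m)"] UN_I[of b]) auto
        qed simp
      qed
      ultimately have "countable (\<A> - (\<Union>t\<in>T. Y p t))" by (rule countable_subset[rotated])
      then show "\<exists>t\<in>T. Y p t \<in> \<U>" by (rule \<U>(2)[OF \<open>finite T\<close>])
    qed
    from bchoice[OF this[unfolded Bex_def]]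
    obtain t where t: "\<And>p. p \<in> \<A> \<Longrightarrow> t p \<in> T" "\<And>p. p \<in> \<A> \<Longrightarrow> Y p (t p) \<in> \<U>" by blast
    have "\<exists>t0\<in>T. uncountable {p \<in> \<A>. t p = t0}"
    proof (rule ccontr)
      assume "\<not> ?thesis"
      then have "countable (\<Union>t0\<in>T. {p \<in> \<A>. t p = t0})"
        using \<open>finite T\<close> by (intro countable_UN) (auto intro: countable_finite)
      moreover have "\<A> = (\<Union>t0\<in>T. {p \<in> \<A>. t p = t0})" using t(1) by auto
      ultimately show False using unc by simp
    qed
    then obtain i j where ij: "i < Suc n" "j < Suc n" and unc': "uncountable {p \<in> \<A>. t p = (i, j)}"
      by (auto simp: T_def)
    let ?P = "{p \<in> \<A>. t p = (i, j)}"
    define x where "x p = fst (e p i)" for p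
    have in_e: "e p k \<in> p" if "p \<in> \<A>" "k < Suc n" for p k using e[OF that(1)] that(2) by blast
    then have inS: "fst (e p k) \<in> S" if "p \<in> \<A>" "k < Suc n" for p k using \<A>[OF that(1)] that by fastforce
    have "countable (x ` ?P)"
    proof (rule chain)
      show "x ` ?P \<subseteq> S" using inS ij by (auto simp: x_def)
      \<comment> \<open>A set \<open>q\<close> in both ultrafilter members has its point number
        \<open>j\<close> above both \<open>x p\<close> and \<open>x p'\<close>, and predecessors of
        a point are linearly ordered.\<close>
      have "x p = x p' \<or> lt (x p) (x p') \<or> lt (x p') (x p)" if pp: "p \<in> ?P" "p' \<in> ?P" for p p'
      proof -
        have "uncountable (\<A> \<inter> \<Inter>{Y p (i, j), Y p' (i, j)})" using t(2)[of p] t(2)[of p'] pp by (intro \<U>(1)) auto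
        then have "\<A> \<inter> \<Inter>{Y p (i, j), Y p' (i, j)} \<noteq> {}" by (metis countable_empty)
        then obtain q where "q \<in> \<A>" "q \<in> Y p (i, j)" "q \<in> Y p' (i, j)" by blast
        then show ?thesis using lin[of "x p" "x p'" "fst (e q j)"] inS ij pp by (auto simp: Y_def x_def)
      qed
      then show "\<forall>a\<in>x ` ?P. \<forall>b\<in>x ` ?P. a \<noteq> b \<longrightarrow> lt a b \<or> lt b a" by blast
    qed
    \<comment> \<open>By \<open>few\<close>, a pair \<open>(a, m)\<close> lies in only countably
      many sets of the family, so countably many values of \<open>x\<close> account for only
      countably many \<open>p\<close>.\<close>
    then have "countable (\<Union>a\<in>x ` ?P. \<Union>m. {p \<in> \<A>. (a, m) \<in> p})"
      by (intro countable_UN few countableI_type)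
    moreover have "?P \<subseteq> (\<Union>a\<in>x ` ?P. \<Union>m. {p \<in> \<A>. (a, m) \<in> p})"
    proof
      fix p assume p: "p \<in> ?P"
      then have "(x p, snd (e p i)) \<in> p" using in_e ij by (simp add: x_def)
      then show "p \<in> (\<Union>a\<in>x ` ?P. \<Union>m. {p \<in> \<A>. (a, m) \<in> p})" using p by blast
    qed
    ultimately show False using unc' countable_subset by blast
  qed
qed

text \<open>Conditions without a mutual conflict are compatible through their union, so antichains
  of a fixed size fall under \<open>countable_conflict_family\<close>. One dense set per point makes
  the generic colouring total.\<close>

lemma specialize_tree:
  fixes S :: "'a set" and lt :: "'a \<Rightarrow> 'a \<Rightarrow> bool"
  assumes MA: "martins_axiom TYPE('p)" "continuum \<le>o |UNIV :: 'p set|" and S: "|S| <o continuum"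
    and irrefl: "\<And>a. \<not> lt a a"
    and lin: "\<And>a b c. a \<in> S \<Longrightarrow> b \<in> S \<Longrightarrow> c \<in> S \<Longrightarrow> lt a c \<Longrightarrow> lt b c \<Longrightarrow> a = b \<or> lt a b \<or> lt b a"
    and pred: "\<And>c. c \<in> S \<Longrightarrow> countable {a \<in> S. lt a c}"
    and chain: "\<And>X. X \<subseteq> S \<Longrightarrow> \<forall>a\<in>X. \<forall>b\<in>X. a \<noteq> b \<longrightarrow> lt a b \<or> lt b a \<Longrightarrow> countable X"
  shows "\<exists>g :: 'a \<Rightarrow> nat. \<forall>a\<in>S. \<forall>b\<in>S. lt a b \<longrightarrow> g a \<noteq> g b"
proof (cases "S = {}")
  case False
  define P where "P = {p :: ('a \<times> nat) set. finite p \<and> p \<subseteq> S \<times> UNIV \<and> \<not> conflict lt p p}"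
  define le where "le = {(p, q). p \<in> P \<and> q \<in> P \<and> q \<subseteq> p}"
  define D where "D a = {p \<in> P. a \<in> fst ` p}" for a
  have nat: "|UNIV :: nat set| \<le>o |UNIV :: 'p set|"
  proof -
    have "natLeq \<le>o continuum" by (rule ordLess_imp_ordLeq[OF ordLess_ctwo_cexp[OF natLeq_Card_order]])
    then have "natLeq \<le>o |UNIV :: 'p set|" using MA(2) by (rule ordLeq_transitive)
    then show ?thesis by (rule ordIso_ordLeq_trans[OF card_of_nat])
  qed
  have "|P| \<le>o |UNIV :: 'p set|"
  proof -
    have "|P| \<le>o |Fpow (S \<times> (UNIV :: nat set))|" by (rule card_of_mono1) (auto simp: P_def Fpow_def)
    also have "|Fpow (S \<times> (UNIV :: nat set))| \<le>o |S \<times> (UNIV :: nat set)|"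
      by (rule card_of_Fpow_ordLeq) (use False in \<open>auto dest: finite_cartesian_productD2\<close>)
    also have "|S \<times> (UNIV :: nat set)| \<le>o |UNIV :: 'p set|"
    proof (rule card_of_Times_ordLeq_infinite_Field)
      show "infinite (Field |UNIV :: 'p set| )"
        using nat by (simp add: Field_card_of infinite_iff_card_of_nat)
      show "|S| \<le>o |UNIV :: 'p set|" using ordLess_imp_ordLeq[OF S] MA(2) by (rule ordLeq_transitive)
    qed (simp_all add: nat card_of_Card_order)
    finally show ?thesis .
  qed
  moreover have "P \<noteq> {}"
  proof -
    have "{} \<in> P" by (simp add: P_def conflict_def)
    then show ?thesis by blast
  qed
  moreover have "partial_order_on P le"
    by (auto simp: partial_order_on_def preorder_on_def refl_on_def le_def intro!: transI antisymI)
  moreover have "ccc P le"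
    unfolding ccc_def
  proof (intro allI impI)
    fix A assume A: "antichain P le A"
    have "countable {p \<in> A. card p = n}" for n
    proof (rule countable_conflict_family[OF lin pred chain])
      show "finite p \<and> p \<subseteq> S \<times> UNIV \<and> card p = n \<and> \<not> conflict lt p p" if "p \<in> {p \<in> A. card p = n}" for p
        using that A by (auto simp: antichain_def P_def)
      fix p q assume pq: "p \<in> {p \<in> A. card p = n}" "q \<in> {p \<in> A. card p = n}" "p \<noteq> q"
      then have pqP: "p \<in> P" "q \<in> P" and inc: "\<not> compatible P le p q" using A by (auto simp: antichain_def)
      have "p \<union> q \<notin> P" using inc pqP by (auto simp: compatible_def le_def)
      then have "conflict lt (p \<union> q) (p \<union> q)" using pqP by (auto simp: P_def)
      moreover have "\<not> conflict lt p p" "\<not> conflict lt q q" using pqP by (auto simp: P_def)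
      ultimately show "conflict lt p q" unfolding conflict_def Un_iff by blast
    qed
    then have "countable (\<Union>n. {p \<in> A. card p = n})" by blast
    moreover have "A = (\<Union>n. {p \<in> A. card p = n})" by blast
    ultimately show "countable A" by simp
  qed
  moreover have "|D ` S| <o continuum" using card_of_image S by (rule ordLeq_ordLess_trans)
  moreover have "dense_in P le E" if E: "E \<in> D ` S" for E
  proof -
    obtain a where a: "a \<in> S" "E = D a" using E by blast
    have "\<exists>d\<in>D a. (d, p) \<in> le" if p: "p \<in> P" for p
    proof -
      have "finite (snd ` p)" using p by (simp add: P_def)
      then obtain m where m: "m \<notin> snd ` p" using ex_new_if_finite infinite_UNIV_nat by blast
      then have "insert (a, m) p \<in> P"
        using p a(1) irrefl by (force simp: P_def conflict_def)
      then show ?thesis using p by (intro bexI[of _ "insert (a, m) p"]) (auto simp: le_def D_def)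
    qed
    then show ?thesis by (auto simp: dense_in_def a(2) D_def)
  qed
  ultimately obtain G where G: "filter_in P le G" "\<And>E. E \<in> D ` S \<Longrightarrow> G \<inter> E \<noteq> {}"
    using martins_axiom_transfer[OF MA(1), of P le "D ` S"] by blast
  have "\<forall>a\<in>S. \<exists>m. \<exists>p\<in>G. (a, m) \<in> p"
  proof
    fix a assume "a \<in> S"
    then obtain p where "p \<in> G" "p \<in> D a" using G(2) by blast
    then show "\<exists>m. \<exists>p\<in>G. (a, m) \<in> p" by (force simp: D_def)
  qed
  from bchoice[OF this] obtain g where g: "\<forall>a\<in>S. \<exists>p\<in>G. (a, g a) \<in> p" by (elim exE)
  have "g a \<noteq> g b" if ab: "a \<in> S" "b \<in> S" "lt a b" for a b
  proof
    assume eq: "g a = g b"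
    obtain p q where pq: "p \<in> G" "q \<in> G" "(a, g a) \<in> p" "(b, g b) \<in> q" using g ab by blast
    then obtain s where "s \<in> G" "(s, p) \<in> le" "(s, q) \<in> le"
      using G(1) unfolding filter_in_def by blast
    then have "s \<in> P" "(a, g a) \<in> s" "(b, g a) \<in> s" using pq eq by (auto simp: le_def)
    then show False using ab(3) by (auto simp: P_def conflict_def)
  qed
  then show ?thesis by blast
qed simp

section \<open>Trees from a counterexample to Chang's conjecture\<close>

text \<open>The map \<pi> identifies \<open>R\<close> with \<open>\<omega>\<^sub>1\<close>, and
  \<open>c \<beta>\<close> codes the predecessors of \<beta> in \<open>R\<close>. Closed sets can
  compute and decode these codes, which allows membership of points of \<open>U\<close> to be
  controlled through \<open>R\<close>.\<close>

locale chang_counterexample =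
  fixes U R :: "'a set" and \<G> :: "('a list \<Rightarrow> 'a) set" and c :: "'a \<Rightarrow> 'a \<Rightarrow> 'a"
    and \<pi> :: "nat set \<Rightarrow> 'a"
  assumes card_U: "|U| =o aleph2"
    and R: "R \<subseteq> U" and \<pi>: "bij_betw \<pi> (Field aleph1) R"
    and \<G>: "countable \<G>" "closed_under \<G> U"
    and infinite_R: "\<And>B. closed_under \<G> B \<Longrightarrow> infinite (B \<inter> R)"
    and no_chang: "\<And>B. B \<subseteq> U \<Longrightarrow> closed_under \<G> B \<Longrightarrow> |B| =o aleph1 \<Longrightarrow> uncountable (B \<inter> R)"
    and c_in_R: "\<And>\<alpha> \<beta>. c \<beta> \<alpha> \<in> R"
    and c_closed: "\<And>B \<alpha> \<beta>. closed_under \<G> B \<Longrightarrow> \<alpha> \<in> B \<Longrightarrow> \<beta> \<in> B \<Longrightarrow> c \<beta> \<alpha> \<in> B"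
    and c_inverse: "\<And>B \<alpha> \<beta>. closed_under \<G> B \<Longrightarrow> \<beta> \<in> B \<Longrightarrow> \<alpha> \<in> underS |U| \<beta> \<Longrightarrow>
      c \<beta> \<alpha> \<in> B \<Longrightarrow> \<alpha> \<in> B"
begin

section \<open>Hulls over initial segments of \<open>R\<close> and their tree order\<close>

abbreviation less_U (infix "\<lless>" 50) where "\<alpha> \<lless> \<beta> \<equiv> \<alpha> \<in> underS |U| \<beta>"

lemma less_U_linear: "\<alpha> \<in> U \<Longrightarrow> \<beta> \<in> U \<Longrightarrow> \<alpha> = \<beta> \<or> \<alpha> \<lless> \<beta> \<or> \<beta> \<lless> \<alpha>"
  using card_of_well_order_on[of U]
  by (auto simp: underS_def well_order_on_def linear_order_on_def total_on_def)

definition Sk :: "nat set \<Rightarrow> 'a \<Rightarrow> 'a set" where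
  "Sk \<delta> \<alpha> = hull \<G> (insert \<alpha> (\<pi> ` underS aleph1 \<delta>))"

text \<open>One inclusion suffices: the generators lie in both the hull and \<open>R\<close>, so the
  other is automatic.\<close>

definition good :: "nat set \<Rightarrow> 'a set" where
  "good \<delta> = {\<alpha> \<in> U. Sk \<delta> \<alpha> \<inter> R \<subseteq> \<pi> ` underS aleph1 \<delta>}"

definition tree :: "nat set \<Rightarrow> 'a \<Rightarrow> 'a \<Rightarrow> bool" where
  "tree \<delta> \<alpha> \<beta> \<longleftrightarrow> \<alpha> \<lless> \<beta> \<and> \<alpha> \<in> Sk \<delta> \<beta>"

lemma \<pi>_underS: "\<pi> ` underS aleph1 \<delta> \<subseteq> R"
  using \<pi> by (auto simp: bij_betw_def underS_def Field_def)

lemma closed_Sk: "closed_under \<G> (Sk \<delta> \<alpha>)"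
  by (simp add: Sk_def closed_under_hull)

lemma generators_in_Sk: "\<alpha> \<in> Sk \<delta> \<alpha>" "\<pi> ` underS aleph1 \<delta> \<subseteq> Sk \<delta> \<alpha>"
  using subset_hull by (fastforce simp: Sk_def)+

lemma Sk_subset: "\<alpha> \<in> Sk \<delta> \<beta> \<Longrightarrow> Sk \<delta> \<alpha> \<subseteq> Sk \<delta> \<beta>"
  unfolding Sk_def[of \<delta> \<alpha>]
  by (intro hull_subset closed_Sk) (simp add: generators_in_Sk)

lemma countable_Sk: "countable (Sk \<delta> \<alpha>)"
  using \<G>(1) countable_underS_aleph1 by (simp add: Sk_def countable_hull)

lemma Sk_subset_U: "\<alpha> \<in> U \<Longrightarrow> Sk \<delta> \<alpha> \<subseteq> U"
  unfolding Sk_def using \<pi>_underS R \<G>(2) by (intro hull_subset) auto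

lemma in_Sk_of_c:
  assumes "\<alpha> \<lless> \<beta>" "c \<beta> \<alpha> \<in> \<pi> ` underS aleph1 \<delta>"
  shows "\<alpha> \<in> Sk \<delta> \<beta>"
  by (rule c_inverse[OF closed_Sk generators_in_Sk(1) assms(1)])
    (use assms(2) generators_in_Sk(2) in blast)

text \<open>The code of \<open>a\<close> below \<open>b\<close> lies in the hull of
  \<open>c'\<close> and in \<open>R\<close>. Goodness of \<open>c'\<close> puts it among the
  generators below \<delta>, so the hull of \<open>b\<close> can decode it.\<close>

lemma tree_linear_less:
  assumes "c' \<in> good \<delta>" "tree \<delta> a c'" "tree \<delta> b c'" "a \<lless> b"
  shows "tree \<delta> a b"
proof -
  have "c b a \<in> Sk \<delta> c' \<inter> R"
    using assms c_in_R c_closed[OF closed_Sk] by (simp add: tree_def)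
  then have "c b a \<in> \<pi> ` underS aleph1 \<delta>" using assms(1) by (auto simp: good_def)
  then show ?thesis using assms(4) by (simp add: tree_def in_Sk_of_c)
qed

lemma tree_linear:
  assumes "a \<in> good \<delta>" "b \<in> good \<delta>" "c' \<in> good \<delta>" "tree \<delta> a c'" "tree \<delta> b c'"
  shows "a = b \<or> tree \<delta> a b \<or> tree \<delta> b a"
proof -
  have "a \<in> U" "b \<in> U" using assms(1,2) by (simp_all add: good_def)
  then consider "a = b" | "a \<lless> b" | "b \<lless> a" using less_U_linear by blast
  then show ?thesis
    using tree_linear_less[OF assms(3,4,5)] tree_linear_less[OF assms(3,5,4)] by cases simp_all
qed

text \<open>Hulls along a chain are nested, so their union is closed. All of them meet
  \<open>R\<close> inside the same countable set, which is impossible for a union of size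
  \<open>\<aleph>\<^sub>1\<close>.\<close>

lemma countable_chain:
  assumes X: "X \<subseteq> good \<delta>" and chain: "\<forall>a\<in>X. \<forall>b\<in>X. a \<noteq> b \<longrightarrow> tree \<delta> a b \<or> tree \<delta> b a"
  shows "countable X"
proof (rule ccontr)
  assume unc: "uncountable X"
  then have "natLeq <o |X|"
    using not_ordLeq_iff_ordLess[OF natLeq_Well_order card_of_Well_order[of X]]
    by (simp add: countable_card_le_natLeq)
  then have "aleph1 \<le>o |X|" by (rule cardSuc_least[OF natLeq_Card_order card_of_Card_order])
  then have "|Field aleph1| \<le>o |X|"
    by (rule ordIso_ordLeq_trans[OF card_of_Field_ordIso[OF cardSuc_Card_order[OF natLeq_Card_order]]])
  then obtain f where f: "inj_on f (Field aleph1)" "f ` Field aleph1 \<subseteq> X"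
    by (auto simp: card_of_ordLeq[symmetric])
  \<comment> \<open>The chain is thinned to size exactly \<open>\<aleph>\<^sub>1\<close>, as
    \<open>no_chang\<close> requires.\<close>
  define X0 where "X0 = f ` Field aleph1"
  have X0: "X0 \<subseteq> X" "|X0| =o aleph1"
  proof -
    have "|X0| =o |Field aleph1|"
      using f(1) card_of_ordIso inj_on_imp_bij_betw ordIso_symmetric unfolding X0_def by blast
    then show "|X0| =o aleph1"
      by (rule ordIso_transitive[OF _ card_of_Field_ordIso[OF cardSuc_Card_order[OF natLeq_Card_order]]])
  qed (simp add: X0_def f(2))
  have unc0: "uncountable X0"
    using X0(2) unfolding countable_card_of_ordLess_aleph1 by (meson not_ordLess_ordIso)
  let ?B = "\<Union>(Sk \<delta> ` X0)"
  have dir: "\<exists>D\<in>Sk \<delta> ` X0. B \<union> C \<subseteq> D" if BC: "B \<in> Sk \<delta> ` X0" "C \<in> Sk \<delta> ` X0" for B C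
  proof -
    obtain a b where ab: "a \<in> X0" "B = Sk \<delta> a" "b \<in> X0" "C = Sk \<delta> b" using BC by blast
    then have "a = b \<or> tree \<delta> a b \<or> tree \<delta> b a" using chain X0(1) by blast
    then have "B \<subseteq> C \<or> C \<subseteq> B" using ab Sk_subset by (auto simp: tree_def)
    then show ?thesis using BC by blast
  qed
  have closed: "closed_under \<G> ?B"
  proof (rule closed_under_directed_Union[OF _ _ dir])
    show "Sk \<delta> ` X0 \<noteq> {}" using unc0 by auto
  qed (auto simp: closed_Sk)
  have "X0 \<subseteq> U" using X X0(1) by (auto simp: good_def)
  then have "?B \<subseteq> U" using Sk_subset_U by blast
  moreover have "|?B| =o aleph1"
  proof -
    have inf: "infinite X0" using unc0 by (rule uncountable_infinite)
    have "|?B| \<le>o |X0|"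
    proof (rule card_of_UNION_ordLeq_infinite[OF inf card_of_refl[THEN ordIso_imp_ordLeq]], rule ballI)
      fix \<alpha>
      have "|Sk \<delta> \<alpha>| \<le>o natLeq" using countable_Sk by (simp add: countable_card_le_natLeq[symmetric])
      moreover have "natLeq \<le>o |X0|" using inf infinite_iff_natLeq_ordLeq by blast
      ultimately show "|Sk \<delta> \<alpha>| \<le>o |X0|" by (rule ordLeq_transitive)
    qed
    moreover have "|X0| \<le>o |?B|" using generators_in_Sk(1) by (intro card_of_mono1) blast
    ultimately have "|?B| =o |X0|" by (simp add: ordIso_iff_ordLeq)
    then show ?thesis using X0(2) by (rule ordIso_transitive)
  qed
  ultimately have "uncountable (?B \<inter> R)" using closed by (intro no_chang)
  moreover have "?B \<inter> R \<subseteq> \<pi> ` underS aleph1 \<delta>"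
  proof -
    have "Sk \<delta> \<alpha> \<inter> R \<subseteq> \<pi> ` underS aleph1 \<delta>" if "\<alpha> \<in> X0" for \<alpha>
      using X X0(1) that by (auto simp: good_def)
    then show ?thesis by blast
  qed
  then have "countable (?B \<inter> R)"
    by (rule countable_subset) (simp add: countable_underS_aleph1)
  ultimately show False by contradiction
qed

end

lemma no_chang_counterexample:
  assumes "\<not> chang_conjecture TYPE('a) TYPE('f) TYPE('r)"
  obtains U R :: "'a set" and \<G> c \<pi> where "chang_counterexample U R \<G> c \<pi>"
proof -
  obtain U R :: "'a set" and \<G>0 :: "('a list \<Rightarrow> 'a) set" where
    card_U: "|U| =o aleph2" and card_R: "|R| =o aleph1" and RU: "R \<subseteq> U"
    and \<G>0: "countable \<G>0" "closed_under \<G>0 U"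
    and no: "\<And>B. B \<subseteq> U \<Longrightarrow> closed_under \<G>0 B \<Longrightarrow> |B| =o aleph1 \<Longrightarrow> \<not> |B \<inter> R| =o aleph0"
    using no_chang_algebra[OF assms] by metis
  have Card: "Card_order aleph1" by (rule cardSuc_Card_order[OF natLeq_Card_order])
  have "|Field aleph1| =o |R|"
    using card_of_Field_ordIso[OF Card] ordIso_symmetric[OF card_R] by (rule ordIso_transitive)
  then obtain \<pi> where \<pi>: "bij_betw \<pi> (Field aleph1) R" by (auto simp: card_of_ordIso[symmetric])
  have "infinite R"
    using card_R by (meson countable_card_of_ordLess_aleph1 countable_finite not_ordLess_ordIso)
  then obtain r :: "nat \<Rightarrow> 'a" where r: "inj r" "range r \<subseteq> R"
    using infinite_countable_subset by blast
  \<comment> \<open>A proper initial segment of a cardinal order of size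
    \<open>\<aleph>\<^sub>2\<close> has size at most \<open>\<aleph>\<^sub>1\<close>, hence injects
    into \<open>R\<close>.\<close>
  have "\<exists>f. inj_on f (underS |U| \<beta>) \<and> f ` underS |U| \<beta> \<subseteq> R" for \<beta>
  proof (cases "\<beta> \<in> U")
    case True
    then have "|underS |U| \<beta>| <o |U|"
      by (intro card_of_underS[OF card_of_Card_order]) (simp add: Field_card_of)
    then have "|underS |U| \<beta>| <o aleph2" using card_U by (rule ordLess_ordIso_trans)
    then have "|underS |U| \<beta>| \<le>o aleph1"
      by (simp add: cardSuc_ordLeq_ordLess Card card_of_Card_order)
    then have "|underS |U| \<beta>| \<le>o |R|" using ordIso_symmetric[OF card_R] by (rule ordLeq_ordIso_trans)
    then show ?thesis by (simp add: card_of_ordLeq)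
  next
    case False
    then have "underS |U| \<beta> = {}" using Field_card_of[of U] by (auto simp: underS_def Field_def)
    then show ?thesis by simp
  qed
  then obtain f where f: "\<And>\<beta>. inj_on (f \<beta>) (underS |U| \<beta>)" "\<And>\<beta>. f \<beta> ` underS |U| \<beta> \<subseteq> R"
    by metis
  define c where "c \<beta> \<alpha> = (if \<alpha> \<in> underS |U| \<beta> then f \<beta> \<alpha> else r 0)" for \<beta> \<alpha>
  define d where "d \<beta> \<rho> = (if \<rho> \<in> f \<beta> ` underS |U| \<beta> then inv_into (underS |U| \<beta>) (f \<beta>) \<rho> else r 0)"
    for \<beta> \<rho>
  \<comment> \<open>Closed sets gain the coding \<open>c\<close>, its decoding \<open>d\<close> and
    the infinitely many constants \<open>r n\<close> from \<open>R\<close>. The latter turn a trace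
    on \<open>R\<close> that is not of size \<open>\<aleph>\<^sub>0\<close> into an uncountable
    one.\<close>
  define \<G> where "\<G> = \<G>0 \<union> {\<lambda>xs. c (xs ! 0) (xs ! 1), \<lambda>xs. d (xs ! 0) (xs ! 1)} \<union> range (\<lambda>n _. r n)"
  have cR: "c \<beta> \<alpha> \<in> R" for \<alpha> \<beta> using f(2)[of \<beta>] r(2) by (auto simp: c_def)
  have underU: "underS |U| \<beta> \<subseteq> U" for \<beta> using Field_card_of[of U] by (auto simp: underS_def Field_def)
  have dU: "d \<beta> \<rho> \<in> U" for \<beta> \<rho>
  proof -
    have "r 0 \<in> U" using r(2) RU by blast
    then show ?thesis
      using inv_into_into[of \<rho> "f \<beta>" "underS |U| \<beta>"] underU by (auto simp: d_def)
  qed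
  have dc: "d \<beta> (c \<beta> \<alpha>) = \<alpha>" if "\<alpha> \<in> underS |U| \<beta>" for \<alpha> \<beta>
    using that f(1) by (simp add: c_def d_def)
  have closedD: "\<And>xs. xs \<in> lists B \<Longrightarrow> g xs \<in> B" if "closed_under \<G> B" "g \<in> \<G>" for B g
    using that unfolding closed_under_def by blast
  have "chang_counterexample U R \<G> c \<pi>"
  proof
    show "countable \<G>" using \<G>0(1) by (simp add: \<G>_def)
    show "closed_under \<G> U"
      using \<G>0(2) cR dU r(2) RU unfolding closed_under_def \<G>_def by blast
    show "c \<beta> \<alpha> \<in> R" for \<beta> \<alpha> by (rule cR)
    fix B assume B: "closed_under \<G> B"
    show inf: "infinite (B \<inter> R)"
    proof -
      have "r n \<in> B" for n using closedD[OF B, of "\<lambda>_. r n" "[]"] by (auto simp: \<G>_def)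
      then have "range r \<subseteq> B \<inter> R" using r(2) by blast
      then show ?thesis using r(1) finite_subset range_inj_infinite by blast
    qed
    show "uncountable (B \<inter> R)" if "B \<subseteq> U" "|B| =o aleph1"
    proof
      assume "countable (B \<inter> R)"
      then have "|B \<inter> R| \<le>o aleph0" by (simp add: countable_card_le_natLeq)
      moreover have "aleph0 \<le>o |B \<inter> R|" using inf infinite_iff_natLeq_ordLeq by blast
      ultimately have "|B \<inter> R| =o aleph0" unfolding ordIso_iff_ordLeq by (rule conjI)
      moreover have "closed_under \<G>0 B" using B by (auto simp: closed_under_def \<G>_def)
      ultimately show False using no that by blast
    qed
    show "c \<beta> \<alpha> \<in> B" if "\<alpha> \<in> B" "\<beta> \<in> B" for \<alpha> \<beta>
      using closedD[OF B, of "\<lambda>xs. c (xs ! 0) (xs ! 1)" "[\<beta>, \<alpha>]"] that by (simp add: \<G>_def)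
    show "\<alpha> \<in> B" if "\<beta> \<in> B" "\<alpha> \<in> underS |U| \<beta>" "c \<beta> \<alpha> \<in> B" for \<alpha> \<beta>
      using closedD[OF B, of "\<lambda>xs. d (xs ! 0) (xs ! 1)" "[\<beta>, c \<beta> \<alpha>]"] that dc by (simp add: \<G>_def)
  qed (fact card_U RU \<pi>)+
  then show ?thesis by (rule that)
qed

section \<open>Colourings of all trees against saturation\<close>

locale weakly_laver_and_chang_counterexample = weakly_laver_ideal + chang_counterexample
begin

text \<open>Let \<open>g \<xi>\<close> bound the indices of \<open>R\<close> in the hull of \<alpha>
  and the points up to \<xi>. By normality \<open>h x\<close> is almost always closed under
  \<open>g\<close>, and each element of the hull at \<open>h x\<close> already arises from some
  \<xi> below it.\<close>

lemma almost_all_good: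
  assumes A: "small h A"
    and normal: "\<And>g. g ` W \<subseteq> W \<Longrightarrow> {x \<in> A. \<exists>\<xi>. \<xi> \<prec> h x \<and> \<not> g \<xi> \<prec> h x} \<in> I"
    and \<alpha>: "\<alpha> \<in> U"
  shows "{x \<in> A. \<alpha> \<notin> good (h x)} \<in> I"
proof -
  define H where "H \<xi> = insert \<alpha> (\<pi> ` insert \<xi> (underS aleph1 \<xi>))" for \<xi>
  have "\<exists>\<delta>. \<delta> \<in> W \<and> (\<forall>\<eta>\<in>W. \<pi> \<eta> \<in> hull \<G> (H \<xi>) \<longrightarrow> \<eta> \<prec> \<delta>)" for \<xi>
  proof -
    have "countable (hull \<G> (H \<xi>))"
      using \<G>(1) countable_underS_aleph1 by (simp add: H_def countable_hull)
    then have "countable (\<pi> ` {\<eta> \<in> W. \<pi> \<eta> \<in> hull \<G> (H \<xi>)})" by (rule countable_subset[rotated]) auto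
    moreover have "inj_on \<pi> {\<eta> \<in> W. \<pi> \<eta> \<in> hull \<G> (H \<xi>)}"
      using \<pi> by (auto simp: bij_betw_def intro: inj_on_subset)
    ultimately have "countable {\<eta> \<in> W. \<pi> \<eta> \<in> hull \<G> (H \<xi>)}" by (rule countable_image_inj_on)
    then obtain \<delta> where "\<delta> \<in> W" "\<And>\<eta>. \<eta> \<in> {\<eta> \<in> W. \<pi> \<eta> \<in> hull \<G> (H \<xi>)} \<Longrightarrow> \<eta> \<prec> \<delta>"
      by (rule ex_upper_bound) auto
    then show ?thesis by blast
  qed
  then obtain g where g: "\<And>\<xi>. g \<xi> \<in> W" "\<And>\<xi> \<eta>. \<eta> \<in> W \<Longrightarrow> \<pi> \<eta> \<in> hull \<G> (H \<xi>) \<Longrightarrow> \<eta> \<prec> g \<xi>"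
    by metis
  \<comment> \<open>Requiring \<open>w\<close> below \<delta> makes its initial segment nonempty, so
    that some \<open>H \<xi>\<close> covers the generator \<alpha>.\<close>
  have "W \<noteq> {}" using Field_aleph1_uncountable by (metis countable_empty)
  then obtain w where w: "w \<in> W" by blast
  have "\<alpha> \<in> good \<delta>" if lim: "w \<prec> \<delta>" and cl: "\<And>\<xi>. \<xi> \<prec> \<delta> \<Longrightarrow> g \<xi> \<prec> \<delta>" for \<delta>
  proof -
    have "z \<in> \<pi> ` underS aleph1 \<delta>" if z: "z \<in> Sk \<delta> \<alpha>" "z \<in> R" for z
    proof -
      obtain F where F: "F \<in> Fpow (insert \<alpha> (\<pi> ` underS aleph1 \<delta>))" "z \<in> hull \<G> F"
        using z(1) equalityD1[OF hull_finitary[of \<G>]] unfolding Sk_def by blast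
      have "\<exists>D\<in>H ` underS aleph1 \<delta>. F \<subseteq> D"
      proof (rule finite_subset_directed_Union)
        show "finite F" using F(1) by (simp add: Fpow_def)
        show "H ` underS aleph1 \<delta> \<noteq> {}" using lim by blast
        show "F \<subseteq> \<Union>(H ` underS aleph1 \<delta>)" using F(1) lim by (fastforce simp: Fpow_def H_def)
        fix B C assume BC: "B \<in> H ` underS aleph1 \<delta>" "C \<in> H ` underS aleph1 \<delta>"
        then obtain \<xi> \<eta> where *: "\<xi> \<prec> \<delta>" "\<eta> \<prec> \<delta>" "B = H \<xi>" "C = H \<eta>" by blast
        have mono: "H \<mu> \<subseteq> H \<nu>" if "\<mu> \<prec> \<nu>" for \<mu> \<nu>
          using that less_W_trans by (auto simp: H_def)
        have "\<xi> \<prec> \<eta> \<or> \<xi> = \<eta> \<or> \<eta> \<prec> \<xi>"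
          using *(1,2) by (intro less_W_linear less_W_Field(1))
        then have "B \<subseteq> C \<or> C \<subseteq> B" using mono unfolding *(3,4) by blast
        then have "B \<union> C = B \<or> B \<union> C = C" by blast
        then show "\<exists>D\<in>H ` underS aleph1 \<delta>. B \<union> C \<subseteq> D"
          using BC by auto
      qed
      then obtain \<xi> where \<xi>: "\<xi> \<prec> \<delta>" "F \<subseteq> H \<xi>" by blast
      obtain \<eta> where \<eta>: "\<eta> \<in> W" "z = \<pi> \<eta>" using \<pi> z(2) by (auto simp: bij_betw_def)
      have "\<eta> \<prec> g \<xi>" using g(2) \<eta> F(2) hull_mono[OF \<xi>(2)] by blast
      then show ?thesis using cl[OF \<xi>(1)] less_W_trans \<eta>(2) by blast
    qed
    then show ?thesis using \<alpha> by (auto simp: good_def)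
  qed
  then have "{x \<in> A. \<alpha> \<notin> good (h x)} \<subseteq>
      {x \<in> A. \<not> w \<prec> h x} \<union> {x \<in> A. \<exists>\<xi>. \<xi> \<prec> h x \<and> \<not> g \<xi> \<prec> h x}" by blast
  moreover have "g ` W \<subseteq> W" using g(1) by blast
  ultimately show ?thesis
    by (intro in_I_subset[OF Un_in_I[OF small_bounded[OF A w] normal[of g]]])
qed

lemma no_tree_colouring:
  fixes g :: "nat set \<Rightarrow> 'a \<Rightarrow> nat"
  assumes g: "\<And>\<delta> \<alpha> \<beta>. \<alpha> \<in> good \<delta> \<Longrightarrow> \<beta> \<in> good \<delta> \<Longrightarrow> tree \<delta> \<alpha> \<beta> \<Longrightarrow> g \<delta> \<alpha> \<noteq> g \<delta> \<beta>"
  shows False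
proof (rule ex_normal_function)
  fix h A
  assume A: "positive A" "small h A"
    and normal: "\<And>g. g ` W \<subseteq> W \<Longrightarrow> {x \<in> A. \<exists>\<xi>. \<xi> \<prec> h x \<and> \<not> g \<xi> \<prec> h x} \<in> I"
  define Y where "Y \<alpha> n = {x \<in> A. \<alpha> \<in> good (h x) \<and> g (h x) \<alpha> = n}" for \<alpha> n
  have AW: "A \<subseteq> W" using A(1) by (simp add: positive_def)
  have "\<exists>n. positive (Y \<alpha> n)" if \<alpha>: "\<alpha> \<in> U" for \<alpha>
  proof (rule ccontr)
    \<comment> \<open>Up to a null set, \<open>A\<close> is the union of the countably many colour
      classes of \<alpha>.\<close>
    assume "\<nexists>n. positive (Y \<alpha> n)"
    then have "Y \<alpha> n \<in> I" for n using AW by (auto simp: positive_def Y_def)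
    then have "(\<Union>n. Y \<alpha> n) \<in> I" by (intro countable_UN_in_I) auto
    then have "(\<Union>n. Y \<alpha> n) \<union> {x \<in> A. \<alpha> \<notin> good (h x)} \<in> I"
      using almost_all_good[OF A(2) normal \<alpha>] by (rule Un_in_I)
    then have "A \<in> I" by (rule in_I_subset) (auto simp: Y_def)
    then show False using A(1) by (simp add: positive_def)
  qed
  then obtain n where n: "\<And>\<alpha>. \<alpha> \<in> U \<Longrightarrow> positive (Y \<alpha> (n \<alpha>))" by metis
  have no: False if \<alpha>\<beta>: "\<alpha> \<lless> \<beta>" "n \<alpha> = n \<beta>" and pos: "positive (Y \<alpha> (n \<alpha>) \<inter> Y \<beta> (n \<beta>))" for \<alpha> \<beta>
  proof -
    \<comment> \<open>Let \<open>w\<close> be the index of the code of \<alpha> below \<beta>. At a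
      point of the positive intersection with \<open>h x\<close> above \<open>w\<close>, the hull of
      \<beta> decodes \<alpha>.\<close>
    obtain w where w: "w \<in> W" "\<pi> w = c \<beta> \<alpha>" using \<pi> c_in_R[of \<beta> \<alpha>] by (auto simp: bij_betw_def)
    have "\<not> Y \<alpha> (n \<alpha>) \<inter> Y \<beta> (n \<beta>) \<subseteq> {x \<in> A. \<not> w \<prec> h x}"
      using small_bounded[OF A(2) w(1)] in_I_subset pos by (auto simp: positive_def)
    then obtain x where x: "x \<in> Y \<alpha> (n \<alpha>)" "x \<in> Y \<beta> (n \<beta>)" "w \<prec> h x" by (auto simp: Y_def)
    then have "\<alpha> \<in> Sk (h x) \<beta>" using w(2) by (intro in_Sk_of_c \<alpha>\<beta>(1)) (metis imageI)
    then have "tree (h x) \<alpha> \<beta>" using \<alpha>\<beta>(1) by (simp add: tree_def)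
    then show False using g[of \<alpha> "h x" \<beta>] x \<alpha>\<beta>(2) by (simp add: Y_def)
  qed
  have "|Field aleph2| =o |U|"
    using card_of_Field_ordIso[OF cardSuc_Card_order[OF cardSuc_Card_order[OF natLeq_Card_order]]]
      ordIso_symmetric[OF card_U] by (rule ordIso_transitive)
  then obtain k where k: "bij_betw k (Field aleph2) U" by (auto simp: card_of_ordIso[symmetric])
  then have kU: "k i \<in> U" if "i \<in> Field aleph2" for i using that by (auto simp: bij_betw_def)
  then have "positive (Y (k i) (n (k i)))" if "i \<in> Field aleph2" for i using n that by blast
  then obtain i j where ij: "i \<in> Field aleph2" "j \<in> Field aleph2" "i \<noteq> j" "n (k i) = n (k j)"
    and pos: "positive (Y (k i) (n (k i)) \<inter> Y (k j) (n (k j)))"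
    using saturated_pair[of "\<lambda>i. Y (k i) (n (k i))" "\<lambda>i. n (k i)"] by metis
  have "k i \<noteq> k j" using k ij by (auto simp: bij_betw_def dest: inj_onD)
  then consider "k i \<lless> k j" | "k j \<lless> k i" using less_U_linear kU ij by blast
  then show False
  proof cases
    case 1
    then show False using no ij(4) pos by blast
  next
    case 2
    then show False using no[of "k j" "k i"] ij(4) pos by (simp add: Int_commute)
  qed
qed

end

theorem theorem1p2:
  assumes "continuum \<le>o |UNIV :: 'p set|"
    and "martins_axiom TYPE('p)"
    and "aleph2 <o continuum"
    and "\<not> chang_conjecture TYPE('a) TYPE('f) TYPE('r)"
  shows "\<not> (\<exists>I. weakly_laver aleph0 I)"
proof
  assume "\<exists>I. weakly_laver aleph0 I"
  then obtain I where I: "weakly_laver aleph0 I" ..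
  obtain U R :: "'a set" and \<G> c \<pi> where cc: "chang_counterexample U R \<G> c \<pi>"
    using no_chang_counterexample[OF assms(4)] by blast
  interpret weakly_laver_and_chang_counterexample I U R \<G> c \<pi>
    using I cc by (simp add: weakly_laver_and_chang_counterexample_def weakly_laver_ideal_def)
  \<comment> \<open>Each \<delta> gets its own application of Martin's axiom, with at most
    \<open>\<aleph>\<^sub>2\<close> dense sets; the colourings are then chosen
    simultaneously.\<close>
  have "\<exists>g :: 'a \<Rightarrow> nat. \<forall>\<alpha>\<in>good \<delta>. \<forall>\<beta>\<in>good \<delta>. tree \<delta> \<alpha> \<beta> \<longrightarrow> g \<alpha> \<noteq> g \<beta>" for \<delta>
  proof (rule specialize_tree[OF assms(2,1)])
    have "|good \<delta>| \<le>o |U|" by (rule card_of_mono1) (auto simp: good_def)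
    then have "|good \<delta>| \<le>o aleph2" using card_U by (rule ordLeq_ordIso_trans)
    then show "|good \<delta>| <o continuum" using assms(3) by (rule ordLeq_ordLess_trans)
    show "\<not> tree \<delta> a a" for a by (simp add: tree_def underS_def)
    show "countable {a \<in> good \<delta>. tree \<delta> a c'}" for c'
      using countable_Sk by (rule countable_subset[rotated]) (auto simp: tree_def)
  qed (fact tree_linear, fact countable_chain)
  then obtain g :: "nat set \<Rightarrow> 'a \<Rightarrow> nat" where
    "\<And>\<delta>. \<forall>\<alpha>\<in>good \<delta>. \<forall>\<beta>\<in>good \<delta>. tree \<delta> \<alpha> \<beta> \<longrightarrow> g \<delta> \<alpha> \<noteq> g \<delta> \<beta>" by metis
  then show False by (intro no_tree_colouring[of g]) blast
qed

end
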